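(* Let $D\ge 2$ be an integer, $\mathbb T=\{1,2,\ldots,\lfloor D/2\rfloor\}$, $g\in\mathcal G$, and let $(A^{(N)},N\in\mathbb N)$ be a $g$-smoothly-scaling family of bit-arrival processes with mean parameter $\lambda$, $0<\lambda<r_{\max}$, and limiting $g$-scaled logarithmic moment generating function $\Lambda$. Consider the concatenated queue/channel system described in the context, with channel diversity function $d_{\mathrm{ch}}(r,T)$, maximal multiplexing gain $r_{\max}$, total error probability $P_{\mathrm{tot}}(r,T)$ at SNR $\rho$ (with $N=\log\rho$), and with $I(r,T)$ the function defined in the context. The optimal rate of decay of the asymptotic total probability of bit error, maximized over $r\in(\lambda,r_{\max})$ and $T\in\mathbb T$, and (in Case 1) the optimizing $r^*$ and $T^*$, are as follows. Case 1. If $\lim_{N\to\infty}\frac{g(N)}{N}=\gamma\in(0,\infty)$, then $$d^*:=\sup_{r\in(\lambda,r_{\max}),\,T\in\mathbb T}\ \lim_{\rho\to\infty}\frac{-\log P_{\mathrm{tot}}(r,T)}{\log\rho}=d_{\mathrm{ch}}(r^*,T^* )=\gamma I(r^*,T^* ),$$ where $$r^*(T):=\inf\{r\in(\lambda,r_{\max}):\gamma I(r,T)=d_{\mathrm{ch}}(r,T)\},\qquad T^*=\arg\max_{T\in\mathbb T} I(r^*(T),T),\qquad r^*=r^*(T^* ).$$ Case 2. If $\lim_{N\to\infty}\frac{g(N)}{N}=0$ and $\lim_{N\to\infty}\frac{g(N)}{\log N}=\infty$, then $$\sup_{r\in(\lambda,r_{\max}),\,T\in\mathbb T}\ \lim_{\rho\to\infty}\frac{-\log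 P_{\mathrm{tot}}(r,T)}{g(\log\rho)}\le\max_{T\in\mathbb T} I(r_{\max},T).$$ Case 3. If $\lim_{N\to\infty}\frac{g(N)}{N}=\infty$, then $$\sup_{r\in(\lambda,r_{\max}),\,T\in\mathbb T}\ \lim_{\rho\to\infty}\frac{-\log P_{\mathrm{tot}}(r,T)}{\log\rho}\le d_{\mathrm{ch}}\Bigl(\lambda,\Bigl\lfloor\frac D2\Bigr\rfloor\Bigr).$$
   Context: **Scale.** $\rho$ denotes the signal-to-noise ratio (SNR) and $N=\log\rho$ (natural logarithm); limits as $\rho\to\infty$ and as $N\to\infty$ are the same limits. $\mathbb N$ is the set of positive integers and $\mathbb Z^+$ the set of non-negative integers. **Scaling functions.** $\mathcal G$ is the class of functions $g:\mathbb R^+\to\mathbb R^+$ that are continuous, strictly increasing and satisfy $\lim_{x\to\infty} g(x)/\log x=\infty$. **$g$-smoothly-scaling source.** For each $N$, $A^{(N)}=(A^{(N)}_t,t\in\mathbb Z)$ is an i.i.d. sequence of random numbers of bits ($A^{(N)}_t$ is the number of bits arriving at timeslot $t$, a non-negative integer) with $E[A^{(N)}_t]=\lambda N$, $\lambda>0$. The family is $g$-smoothly-scaling if for every $\theta\in\mathbb R$ the limit $$\Lambda(\theta)=\lim_{N\to\infty}\frac{\log E[\exp(\frac{\theta g(N)}{N}A^{(N)}_1)]}{g(N)}$$ exists in $\mathbb R\cup\{\infty\}$, and $\Lambda$ is finite in a neighborhood of the origin, essentially smooth (its effective domain $\{\Lambda<\infty\}$ has non-empty interior, $\Lambda$ is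 differentiable there, and $|\Lambda'(\theta_n)|\to\infty$ whenever $\theta_n$ converges to a boundary point of the domain) and lower-semicontinuous. $\Lambda^*(x)=\sup_{\theta\in\mathbb R}(\theta x-\Lambda(\theta))$ is its convex conjugate. **Channel.** Bits are sent over a fading channel $\underline y=H\underline x+\underline w$ in blocks of $T$ timeslots at fixed rate $R=r\log\rho=rN$, where $r$ is the multiplexing gain. $P_{\mathrm{ch}}(r,T)=P_{\mathrm{ch}}(r,T,\rho)$ is the codeword error probability of the optimal code with multiplexing gain $r$ and block length $T$ at SNR $\rho$, and $$d_{\mathrm{ch}}(r,T)=-\lim_{\rho\to\infty}\frac{\log P_{\mathrm{ch}}(r,T,\rho)}{\log\rho}.$$ It is assumed that $d_{\mathrm{ch}}(r,T)$ is continuous in $r$, decreasing in $r$ and increasing in $T$; $r_{\max}$ is the smallest $r$ with $d_{\mathrm{ch}}(r,T)=0$, and $0\le r\le r_{\max}$. It is assumed that $\lambda<r_{\max}$. **Queue.** Bits wait in an infinite first-come-first-served buffer. At each time $mT$, $m\in\mathbb Z$, the oldest $RT=rNT$ bits are removed instantaneously, transmitted over the next $T$ timeslots, and decoded only at the end of these $T$ slots. The queue length satisfies $Q^{(N)}_t=[Q^{(N)}_{t-1}+A^{(N)}_t-TR]^+$ if $t=mT$ for some $m\in\mathbb Z$, and $Q^{(N)}_t=Q^{(N)}_{t-1}+A^{(N)}_t$ otherwise, started empty at time $-\infty$ (so it is in its periodic steady state). **Delay violation.** $D$ is the maximum allowable delay in timeslots. A bit arriving at time $i\in\{0,\ldots,T-1\}$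 waits $T-i$ slots until the next service starts, and then a further $\lceil q/(RT)\rceil T$ slots until decoded, where $q$ is the number of bits in the queue up to and including itself. (For the $j$-th bit among those arriving at time $i$, $q=Q^{(N)}_{i-1}+j-RT\cdot\mathbf 1_{\{i=0\}}$; for the last bit one may take $q=Q^{(N)}_i$.) Its delay is $T-i+\lceil q/(RT)\rceil T$. The probability that a randomly chosen bit arriving at time $i$ has delay greater than $D$ is $\sum_{a\ge1}P(A^{(N)}_i=a)\frac1a\sum_{j=1}^aP(\text{delay of the }j\text{-th bit}>D\mid A^{(N)}_i=a)$, and $$P_{\mathrm{delay}}(r,T)=\frac1T\sum_{i=0}^{T-1}P(\text{steady-state delay of a bit arriving at time } i>D).$$ **Total error probability.** $P_{\mathrm{tot}}(r,T)=P_{\mathrm{ch}}(r,T)+(1-P_{\mathrm{ch}}(r,T))P_{\mathrm{delay}}(r,T)$. **The function $I$.** For $T\in\mathbb T$ and $k=D\bmod T$, $$I(r,T)=\min_{t\in\mathbb Z^+:\ tT+T-1-k>0}\ (tT+T-1-k)\,\Lambda^*\Bigl(r+\frac{(D+1-2T)r}{tT+T-1-k}\Bigr).$$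
   Formalization: In Case 1 the formula for d* assumes γI(r,T)=d_ch(r,T) has a solution r in (λ,r_max) for each T; the limits are asserted to exist only where I(·,T) is continuous (Cases 1, 2), and each supremum is over pairs (r,T) whose limit exists. *)

theory Defs
  imports "HOL-Probability.Probability"
begin

section \<open>Extended logarithm and limiting moment generating functions\<close>

text \<open>\<open>ln\<close> on the reals maps 0 to 0; here the logarithm of 0 is \<open>-\<infinity>\<close>, so that a vanishing
  probability has decay exponent \<open>\<infinity>\<close>, and the logarithm of an infinite expectation is \<open>\<infinity>\<close>.\<close>

definition eln :: "ennreal \<Rightarrow> ereal" where
  "eln x = (if x = 0 then -\<infinity> else if x = \<infinity> then \<infinity> else ereal (ln (enn2real x)))"

text \<open>\<open>\<real>\<^sup>+\<close> is rendered as the open half-line: a continuous increasing function on the closed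
  half-line is determined by, and satisfies the same conditions on, the open one.\<close>

definition scaling_function :: "(real \<Rightarrow> real) \<Rightarrow> bool" where
  "scaling_function g \<longleftrightarrow>
     (\<forall>x>0. 0 < g x) \<and> continuous_on {0<..} g \<and> strict_mono_on {0<..} g \<and>
     filterlim (\<lambda>x. g x / ln x) at_top at_top"

definition effective_domain :: "(real \<Rightarrow> ereal) \<Rightarrow> real set" where
  "effective_domain \<Lambda> = {\<theta>. \<Lambda> \<theta> < \<infinity>}"

definition essentially_smooth :: "(real \<Rightarrow> ereal) \<Rightarrow> bool" where
  "essentially_smooth \<Lambda> \<longleftrightarrow>
     (let S = interior (effective_domain \<Lambda>); F = (\<lambda>\<theta>. real_of_ereal (\<Lambda> \<theta>)) in
        S \<noteq> {} \<and> (\<forall>\<theta>\<in>S. F differentiable (at \<theta>)) \<and>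
        (\<forall>\<theta>s b. (\<forall>n. \<theta>s n \<in> S) \<and> \<theta>s \<longlonglongrightarrow> b \<and> b \<in> frontier (effective_domain \<Lambda>) \<longrightarrow>
           filterlim (\<lambda>n. \<bar>deriv F (\<theta>s n)\<bar>) at_top sequentially))"

definition lower_semicontinuous :: "(real \<Rightarrow> ereal) \<Rightarrow> bool" where
  "lower_semicontinuous \<Lambda> \<longleftrightarrow> (\<forall>\<theta>. \<Lambda> \<theta> \<le> Liminf (at \<theta>) \<Lambda>)"

definition convex_conjugate :: "(real \<Rightarrow> ereal) \<Rightarrow> real \<Rightarrow> ereal" where
  "convex_conjugate \<Lambda> x = (SUP \<theta>. ereal (\<theta> * x) - \<Lambda> \<theta>)"


section \<open>Source\<close>

text \<open>\<open>A N t\<close> is the number of bits arriving at slot \<open>t\<close> in the \<open>N\<close>-th system, a random variable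
  on the probability space \<open>M N\<close>.  Only \<open>N \<ge> 1\<close> is constrained.\<close>

definition smoothly_scaling_source ::
  "(real \<Rightarrow> real) \<Rightarrow> real \<Rightarrow> (nat \<Rightarrow> 'a measure) \<Rightarrow> (nat \<Rightarrow> int \<Rightarrow> 'a \<Rightarrow> nat) \<Rightarrow> (real \<Rightarrow> ereal) \<Rightarrow> bool"
where
  "smoothly_scaling_source g lam M A \<Lambda> \<longleftrightarrow>
     (\<forall>N\<ge>1. prob_space (M N) \<and>
        prob_space.indep_vars (M N) (\<lambda>_. count_space UNIV) (A N) UNIV \<and>
        (\<forall>t. distr (M N) (count_space UNIV) (A N t) = distr (M N) (count_space UNIV) (A N 1)) \<and>
        (\<forall>t. integrable (M N) (\<lambda>\<omega>. real (A N t \<omega>)) \<and>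
             (LINT \<omega>|M N. real (A N t \<omega>)) = lam * real N)) \<and>
     (\<forall>\<theta>. \<Lambda> \<theta> \<noteq> -\<infinity> \<and>
        (\<lambda>N. eln (\<integral>\<^sup>+ \<omega>. ennreal (exp (\<theta> * g (real N) / real N * real (A N 1 \<omega>))) \<partial>M N)
              / ereal (g (real N))) \<longlonglongrightarrow> \<Lambda> \<theta>) \<and>
     (\<forall>\<^sub>F \<theta> in nhds 0. \<Lambda> \<theta> < \<infinity>) \<and>
     essentially_smooth \<Lambda> \<and> lower_semicontinuous \<Lambda>"


section \<open>Channel\<close>

text \<open>The fading channel and its optimal codes enter only through the error probability
  \<open>P_ch r T \<rho>\<close>, which is an arbitrary probability whose exponent \<open>d_ch\<close> has the properties below.
  Monotonicity is meant in the weak sense.\<close>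

definition channel :: "(real \<Rightarrow> nat \<Rightarrow> real \<Rightarrow> real) \<Rightarrow> (real \<Rightarrow> nat \<Rightarrow> real) \<Rightarrow> real \<Rightarrow> bool" where
  "channel P_ch d_ch r_max \<longleftrightarrow>
     (\<forall>r\<in>{0..r_max}. \<forall>T\<ge>1. \<forall>\<rho>>1. P_ch r T \<rho> \<in> {0..1}) \<and>
     (\<forall>r\<in>{0..r_max}. \<forall>T\<ge>1.
        ((\<lambda>\<rho>. - (eln (ennreal (P_ch r T \<rho>)) / ereal (ln \<rho>))) \<longlongrightarrow> ereal (d_ch r T)) at_top) \<and>
     (\<forall>T\<ge>1. continuous_on {0..r_max} (\<lambda>r. d_ch r T)) \<and>
     (\<forall>T\<ge>1. antimono_on {0..r_max} (\<lambda>r. d_ch r T)) \<and>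
     (\<forall>r\<in>{0..r_max}. mono_on {1..} (d_ch r)) \<and>
     (\<forall>T\<ge>1. d_ch r_max T = 0 \<and> (\<forall>r\<in>{0..<r_max}. d_ch r T \<noteq> 0))"


section \<open>Queue\<close>

text \<open>\<open>queue_from B T a s n\<close> is the queue length at time \<open>s + n\<close> when the buffer is empty at time
  \<open>s\<close>, with arrivals \<open>a\<close> and up to \<open>B = RT\<close> bits (a real number) removed at multiples of \<open>T\<close>.\<close>

primrec queue_from :: "real \<Rightarrow> nat \<Rightarrow> (int \<Rightarrow> nat) \<Rightarrow> int \<Rightarrow> nat \<Rightarrow> real" where
  "queue_from B T a s 0 = 0"
| "queue_from B T a s (Suc n) =
     (let t = s + int (Suc n); q = queue_from B T a s n + real (a t)
      in if int T dvd t then max 0 (q - B) else q)"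

text \<open>Started empty at time \<open>-\<infinity>\<close>: the starting time \<open>t - n\<close> recedes to \<open>-\<infinity>\<close>.  The limit is
  monotone, and may be \<open>\<infinity>\<close> on a null set.\<close>

definition queue :: "real \<Rightarrow> nat \<Rightarrow> (int \<Rightarrow> nat) \<Rightarrow> int \<Rightarrow> ereal" where
  "queue B T a t = lim (\<lambda>n. ereal (queue_from B T a (t - int n) n))"

lemma queue_from_nonneg: "0 \<le> queue_from B T a s n"
  by (induction n) (auto simp: Let_def)

lemma queue_from_earlier_start: "queue_from B T a s n \<le> queue_from B T a (s - 1) (Suc n)"
proof (induction n)
  case 0
  show ?case using queue_from_nonneg[of B T a "s - 1" "Suc 0"] by simp
next
  case (Suc n)
  have t: "s - 1 + int (Suc (Suc n)) = s + int (Suc n)" by simp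
  show ?case
    using Suc unfolding queue_from.simps(2)[of B T a "s - 1" "Suc n"]
      queue_from.simps(2)[of B T a s n] Let_def t
    by (auto simp del: queue_from.simps)
qed

lemma queue_LIMSEQ: "(\<lambda>n. ereal (queue_from B T a (t - int n) n)) \<longlonglongrightarrow> queue B T a t"
proof -
  have "incseq (\<lambda>n. ereal (queue_from B T a (t - int n) n))"
  proof (rule incseq_SucI)
    fix n
    have "t - int (Suc n) = t - int n - 1" by simp
    then show "ereal (queue_from B T a (t - int n) n) \<le> ereal (queue_from B T a (t - int (Suc n)) (Suc n))"
      using queue_from_earlier_start[of B T a "t - int n" n] by (simp only: ereal_less_eq)
  qed
  from LIMSEQ_SUP[OF this] show ?thesis
    unfolding queue_def by (metis limI)
qed

lemma queue_nonneg: "0 \<le> queue B T a t"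
  by (rule LIMSEQ_le_const[OF queue_LIMSEQ]) (simp add: queue_from_nonneg)

text \<open>\<open>queue\<close> solves the recursion defining the queue length.\<close>

lemma queue_recursion:
  "queue B T a t =
     (if int T dvd t then max 0 (queue B T a (t - 1) + ereal (real (a t)) - ereal B)
      else queue B T a (t - 1) + ereal (real (a t)))"
proof -
  let ?x = "\<lambda>n. ereal (queue_from B T a (t - 1 - int n) n)"
  have add: "(\<lambda>n. ?x n + ereal c) \<longlonglongrightarrow> queue B T a (t - 1) + ereal c" for c
    by (intro tendsto_add_left_ereal queue_LIMSEQ) simp
  have minus: "x + ereal c - ereal B = x + ereal (c - B)" for x c
    by (cases x) auto
  have "(\<lambda>n. ereal (queue_from B T a (t - int (Suc n)) (Suc n))) \<longlonglongrightarrow>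
     (if int T dvd t then max 0 (queue B T a (t - 1) + ereal (real (a t)) - ereal B)
      else queue B T a (t - 1) + ereal (real (a t)))"
  proof (cases "int T dvd t")
    case True
    have "(\<lambda>n. max 0 (?x n + ereal (real (a t) - B))) \<longlonglongrightarrow>
        max 0 (queue B T a (t - 1) + ereal (real (a t) - B))"
      by (intro tendsto_max tendsto_const add)
    moreover have "ereal (queue_from B T a (t - int (Suc n)) (Suc n)) =
        max 0 (?x n + ereal (real (a t) - B))" for n
      using True by (simp add: Let_def algebra_simps zero_ereal_def flip: ereal_max)
    ultimately show ?thesis using True by (simp only: minus if_True)
  next
    case False
    have "ereal (queue_from B T a (t - int (Suc n)) (Suc n)) = ?x n + ereal (real (a t))" for n
      using False by (simp add: Let_def algebra_simps)
    with False add show ?thesis by (simp only: if_False)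
  qed
  moreover have "(\<lambda>n. ereal (queue_from B T a (t - int (Suc n)) (Suc n))) \<longlonglongrightarrow> queue B T a t"
    using LIMSEQ_Suc[OF queue_LIMSEQ] .
  ultimately show ?thesis by (rule LIMSEQ_unique[symmetric])
qed


section \<open>Delay and total error probability\<close>

text \<open>Number of bits in the queue up to and including the \<open>j\<close>-th bit arriving at time \<open>i\<close>.\<close>

definition bit_position :: "real \<Rightarrow> nat \<Rightarrow> (int \<Rightarrow> nat) \<Rightarrow> nat \<Rightarrow> nat \<Rightarrow> ereal" where
  "bit_position B T a i j =
     queue B T a (int i - 1) + ereal (real j - (if i = 0 then B else 0))"

definition bit_delay :: "real \<Rightarrow> nat \<Rightarrow> nat \<Rightarrow> ereal \<Rightarrow> ereal" where
  "bit_delay B T i q =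
     (if q = \<infinity> then \<infinity>
      else ereal (real T - real i + real_of_int \<lceil>real_of_ereal q / B\<rceil> * real T))"

definition delay_violation_at ::
  "'a measure \<Rightarrow> (int \<Rightarrow> 'a \<Rightarrow> nat) \<Rightarrow> real \<Rightarrow> nat \<Rightarrow> nat \<Rightarrow> nat \<Rightarrow> real" where
  "delay_violation_at M A B T D i =
     (\<Sum>\<^sub>\<infinity>a\<in>{1..}. \<P>(\<omega> in M. A (int i) \<omega> = a) * (1 / real a) *
        (\<Sum>j=1..a. \<P>(\<omega> in M. bit_delay B T i (bit_position B T (\<lambda>t. A t \<omega>) i j) > ereal (real D)
                        \<bar> A (int i) \<omega> = a)))"

definition delay_prob ::
  "(nat \<Rightarrow> 'a measure) \<Rightarrow> (nat \<Rightarrow> int \<Rightarrow> 'a \<Rightarrow> nat) \<Rightarrow> nat \<Rightarrow> real \<Rightarrow> nat \<Rightarrow> nat \<Rightarrow> real" where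
  "delay_prob M A D r T N =
     (\<Sum>i<T. delay_violation_at (M N) (A N) (r * real N * real T) T D i) / real T"

text \<open>The total error probability of the \<open>N\<close>-th system, i.e. at SNR \<open>\<rho> = exp N\<close>.\<close>

definition total_error_prob ::
  "(real \<Rightarrow> nat \<Rightarrow> real \<Rightarrow> real) \<Rightarrow> (nat \<Rightarrow> 'a measure) \<Rightarrow> (nat \<Rightarrow> int \<Rightarrow> 'a \<Rightarrow> nat) \<Rightarrow> nat \<Rightarrow>
     real \<Rightarrow> nat \<Rightarrow> nat \<Rightarrow> real" where
  "total_error_prob P_ch M A D r T N =
     (let p = P_ch r T (exp (real N)) in p + (1 - p) * delay_prob M A D r T N)"

text \<open>\<open>p N\<close> decays with exponent \<open>L\<close> at speed \<open>s N\<close>: the limit of \<open>- log (p N) / s N\<close> exists and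
  equals \<open>L\<close>.\<close>

definition decay_exponent :: "(nat \<Rightarrow> real) \<Rightarrow> (nat \<Rightarrow> real) \<Rightarrow> ereal \<Rightarrow> bool" where
  "decay_exponent p s L \<longleftrightarrow> (\<lambda>N. - eln (ennreal (p N)) / ereal (s N)) \<longlonglongrightarrow> L"


section \<open>The function I and the optimal multiplexing gain\<close>

text \<open>With \<open>n = t T + T - 1 - (D mod T)\<close>, where the subtraction does not truncate for \<open>T \<ge> 1\<close>.
  The infimum over \<open>t\<close> is attained whenever \<open>r > lam\<close>, since then the terms tend to \<open>\<infinity>\<close>.\<close>

definition I_fun :: "nat \<Rightarrow> (real \<Rightarrow> ereal) \<Rightarrow> real \<Rightarrow> nat \<Rightarrow> ereal" where
  "I_fun D \<Lambda> r T =
     (INF n\<in>{n. \<exists>t. n = t * T + T - 1 - D mod T \<and> n > 0}.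
        ereal (real n) *
        convex_conjugate \<Lambda> (r + (real D + 1 - 2 * real T) * r / real n))"

text \<open>\<open>convex_conjugate \<Lambda>\<close> may jump from a finite value to \<open>\<infinity>\<close> (e.g. for binomial arrivals), and then
  \<open>I_fun D \<Lambda> r T\<close> has jumps in \<open>r\<close>.  At a jump the limit defining the decay exponent need not exist,
  and the set of crossings may be empty, in which case the infimum \<open>r_star\<close> is meaningless.\<close>

definition crossings ::
  "nat \<Rightarrow> (real \<Rightarrow> ereal) \<Rightarrow> (real \<Rightarrow> nat \<Rightarrow> real) \<Rightarrow> real \<Rightarrow> real \<Rightarrow> real \<Rightarrow> nat \<Rightarrow> real set" where
  "crossings D \<Lambda> d_ch lam r_max \<gamma> T =
     {r \<in> {lam<..<r_max}. ereal \<gamma> * I_fun D \<Lambda> r T = ereal (d_ch r T)}"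

definition r_star ::
  "nat \<Rightarrow> (real \<Rightarrow> ereal) \<Rightarrow> (real \<Rightarrow> nat \<Rightarrow> real) \<Rightarrow> real \<Rightarrow> real \<Rightarrow> real \<Rightarrow> nat \<Rightarrow> real" where
  "r_star D \<Lambda> d_ch lam r_max \<gamma> T = Inf (crossings D \<Lambda> d_ch lam r_max \<gamma> T)"

end

theory Submission
  imports Defs
begin

text \<open>Unrolling the queue recursion, a bit arriving at slot \<open>i\<close> is late iff for some window length the
  arrivals of the last \<open>n\<close> slots exceed \<open>(n + D + 1 - 2 T) r N\<close>; after enlarging windows, \<open>n\<close> ranges over
  the index set of \<open>I_fun\<close>, and for \<open>i = T - 1 - D mod T\<close> this is an equivalence.  Chernoff bounds, with
  a fixed exponent for long windows, give decay at rate at least \<open>I\<close>.  Conversely, a late bit is produced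
  by \<open>n\<close> consecutive slots each with \<open>A / N\<close> slightly above \<open>r + (D + 1 - 2 T) r / n\<close>, which gives decay
  at rate at most \<open>I r'\<close> for every \<open>r' > r\<close>; the factor \<open>1 / a\<close> in the choice of a random bit costs
  only a power of \<open>N\<close>.  Adding the channel error, the slower of the two decays wins.  Since
  \<open>I r / r\<close> is nondecreasing and \<open>d_ch\<close> is antitone in \<open>r\<close>, the two curves cross at most once.\<close>

section \<open>Late bits and overloaded windows\<close>

text \<open>The obstacle is that \<open>rate\<close> may jump to \<infinity>. The probability that
  one slot overshoots a level is therefore bounded below only through the rate at a strictly larger
  level, which is where \<open>r' > r\<close> comes from. The loss is harmless where it matters. For
  \<open>r\<close> left of the crossing, the crossing itself serves as \<open>r'\<close>; at the
  crossing and right of it the channel error alone supplies the bound; for slow \<open>g\<close>,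
  \<open>r_max\<close> serves as \<open>r'\<close>. Continuity of \<open>I_fun\<close> enters only
  for the existence of the limit at a general \<open>r\<close>. The single-slot lower bound compares
  generating functions at three slopes. It requires a slope at which the derivative of the limiting
  function is a prescribed level just below \<open>y\<close>; finiteness of \<open>rate y\<close>
  together with essential smoothness provides it.\<close>

definition net_input :: "real \<Rightarrow> nat \<Rightarrow> (int \<Rightarrow> nat) \<Rightarrow> int \<Rightarrow> int \<Rightarrow> real" where
  "net_input B T a s u = (\<Sum>t\<in>{s<..u}. real (a t)) - B * real (card {t\<in>{s<..u}. int T dvd t})"

lemma net_input_refl [simp]: "net_input B T a s s = 0"
  by (simp add: net_input_def)

lemma net_input_step:
  assumes "s < u"
  shows "net_input B T a s u =
    net_input B T a s (u - 1) + real (a u) - (if int T dvd u then B else 0)"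
proof -
  have ins: "{s<..u} = insert u {s<..u - 1}" using assms by auto
  have card: "card {t \<in> insert u {s<..u - 1}. int T dvd t} =
      (if int T dvd u then 1 else 0) + card {t \<in> {s<..u - 1}. int T dvd t}"
  proof (cases "int T dvd u")
    case True
    then have "{t \<in> insert u {s<..u - 1}. int T dvd t} = insert u {t \<in> {s<..u - 1}. int T dvd t}"
      by auto
    moreover have "finite {t \<in> {s<..u - 1}. int T dvd t}" by (rule finite_subset[of _ "{s<..u - 1}"]) auto
    ultimately show ?thesis using True by (simp only: card_insert_disjoint) simp
  next
    case False
    then have "{t \<in> insert u {s<..u - 1}. int T dvd t} = {t \<in> {s<..u - 1}. int T dvd t}"
      by auto
    with False show ?thesis by simp
  qed
  show ?thesis unfolding net_input_def ins card by (auto simp: algebra_simps)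
qed

text \<open>Lindley's formula, one half: \<open>net_input\<close> is the workload without truncation
  at 0, every multiple of \<open>T\<close> counting as a full removal. Opening the window at the
  last slot where truncation took effect makes the two agree.\<close>

lemma queue_from_eq_net_input:
  "\<exists>l\<le>n. queue_from B T a s n = net_input B T a (s + int l) (s + int n)"
proof (induction n)
  case 0
  show ?case by simp
next
  case (Suc n)
  then obtain l where l: "l \<le> n" "queue_from B T a s n = net_input B T a (s + int l) (s + int n)"
    by blast
  let ?t = "s + int (Suc n)"
  have step: "net_input B T a (s + int l) ?t =
      queue_from B T a s n + real (a ?t) - (if int T dvd ?t then B else 0)"
    using net_input_step[of "s + int l" ?t B T a] l by simp
  show ?case
  proof (cases "queue_from B T a s (Suc n) = net_input B T a (s + int l) ?t")
    case True
    then show ?thesis using l(1) by (intro exI[of _ l]) simp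
  next
    case False
    then have "queue_from B T a s (Suc n) = 0"
      using step by (auto simp: Let_def max_def split: if_splits)
    then show ?thesis by (intro exI[of _ "Suc n"]) simp
  qed
qed

text \<open>The other half: truncation can only raise the queue, and the empty window has value
  0.\<close>

lemma net_input_le_queue_from:
  "l \<le> n \<Longrightarrow> net_input B T a (s + int l) (s + int n) \<le> queue_from B T a s n"
proof (induction n)
  case 0
  then show ?case by simp
next
  case (Suc n)
  show ?case
  proof (cases "l = Suc n")
    case True
    then show ?thesis using queue_from_nonneg[of B T a s "Suc n"] by simp
  next
    case False
    with Suc have l: "l \<le> n" by simp
    let ?t = "s + int (Suc n)"
    have "net_input B T a (s + int l) ?t =
      net_input B T a (s + int l) (s + int n) + real (a ?t) - (if int T dvd ?t then B else 0)"
      using net_input_step[of "s + int l" ?t B T a] l by simp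
    then show ?thesis using Suc.IH[OF l] by (auto simp: Let_def)
  qed
qed

lemma dvd_less_iff: "i < T \<Longrightarrow> T dvd i \<longleftrightarrow> i = 0" for i T :: nat
  by (auto dest: dvd_imp_le)

text \<open>The last bit of the slot has the largest position. In \<open>bit_position\<close> the
  removal at slot 0 is subtracted without truncation, which is exactly how \<open>net_input\<close>
  treats its final slot.\<close>

lemma bit_position_gt_imp_net_input:
  assumes i: "i < T" and gt: "bit_position B T a i (a (int i)) > ereal c"
  shows "\<exists>L\<ge>1. net_input B T a (int i - int L) (int i) > c"
proof -
  define d where "d = real (a (int i)) - (if i = 0 then B else 0)"
  have "ereal c < queue B T a (int i - 1) + ereal d"
    using gt by (simp add: bit_position_def d_def)
  then have "ereal (c - d) < queue B T a (int i - 1)"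
    by (cases "queue B T a (int i - 1)") auto
  then have "\<forall>\<^sub>F n in sequentially. ereal (c - d) < ereal (queue_from B T a (int i - 1 - int n) n)"
    by (rule order_tendstoD(1)[OF queue_LIMSEQ])
  then obtain n where n: "c - d < queue_from B T a (int i - 1 - int n) n"
    by (auto simp: eventually_sequentially)
  obtain l where l: "l \<le> n"
      "queue_from B T a (int i - 1 - int n) n = net_input B T a (int i - 1 - int n + int l) (int i - 1)"
    using queue_from_eq_net_input[of n B T a "int i - 1 - int n"] by auto
  \<comment> \<open>The window must also contain slot \<open>i\<close> itself, hence the extra 1 and
    \<open>L \<ge> 1\<close>.\<close>
  have eq: "int i - 1 - int n + int l = int i - int (n - l + 1)" using l(1) by (simp add: of_nat_diff)
  have "net_input B T a (int i - int (n - l + 1)) (int i) > c"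
    using net_input_step[of "int i - int (n - l + 1)" "int i" B T a] n l(2)
    unfolding eq by (simp add: dvd_less_iff[OF i] d_def)
  then show ?thesis by (intro exI[of _ "n - l + 1"]) simp
qed

lemma net_input_gt_imp_bit_position:
  assumes i: "i < T" and L: "L \<ge> 1" and gt: "net_input B T a (int i - int L) (int i) > c"
  shows "bit_position B T a i (a (int i)) > ereal c"
proof -
  define d where "d = real (a (int i)) - (if i = 0 then B else 0)"
  let ?w = "net_input B T a (int i - int L) (int i - 1)"
  have gt': "?w + d > c"
    using net_input_step[of "int i - int L" "int i" B T a] L gt
    by (simp add: dvd_less_iff[OF i] d_def)
  have ev: "ereal ?w \<le> ereal (queue_from B T a (int i - 1 - int n) n)" if "n \<ge> L - 1" for n
    using net_input_le_queue_from[of "n - (L - 1)" n B T a "int i - 1 - int n"] that L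
    by (simp add: of_nat_diff)
  have "ereal ?w \<le> queue B T a (int i - 1)"
    by (rule LIMSEQ_le_const[OF queue_LIMSEQ]) (use ev in blast)
  then have "ereal c < queue B T a (int i - 1) + ereal d"
    using gt' by (cases "queue B T a (int i - 1)") auto
  then show ?thesis by (simp add: bit_position_def d_def)
qed

lemma int_div_less_iff: "0 < d \<Longrightarrow> a div d < q \<longleftrightarrow> a < q * d" for a d q :: int
proof -
  assume d: "0 < d"
  have lo: "a div d * d \<le> a" using d by (simp flip: minus_mod_eq_div_mult)
  have hi: "a < (a div d + 1) * d"
    unfolding distrib_right using pos_mod_bound[OF d, of a] div_mult_mod_eq[of a d] by linarith
  show ?thesis
  proof
    assume "a div d < q"
    then have "(a div d + 1) * d \<le> q * d" using d by (intro mult_right_mono) auto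
    with hi show "a < q * d" by simp
  next
    assume "a < q * d"
    with lo have "a div d * d < q * d" by simp
    with d show "a div d < q" by simp
  qed
qed

lemma card_multiples:
  assumes "T > 0" "s \<le> u"
  shows "int (card {t\<in>{s<..u}. int T dvd t}) = u div int T - s div int T"
proof -
  have "{t\<in>{s<..u}. int T dvd t} = (\<lambda>q. int T * q) ` {s div int T<..u div int T}"
  proof (intro set_eqI iffI)
    fix t assume "t \<in> {t\<in>{s<..u}. int T dvd t}"
    then obtain q where q: "t = int T * q" "s < t" "t \<le> u" by auto
    have "q \<le> u div int T" using q assms int_div_less_iff[of "int T" u q] by (simp add: mult.commute)
    moreover have "s div int T < q" using q assms int_div_less_iff[of "int T" s q] by (simp add: mult.commute)
    ultimately show "t \<in> (\<lambda>q. int T * q) ` {s div int T<..u div int T}" using q by auto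
  next
    fix t assume "t \<in> (\<lambda>q. int T * q) ` {s div int T<..u div int T}"
    then obtain q where q: "t = int T * q" "s div int T < q" "q \<le> u div int T"
      by (auto simp only: greaterThanAtMost_iff)
    have "s < t" using q assms int_div_less_iff[of "int T" s q] by (simp add: mult.commute)
    moreover have "t \<le> u" using q assms int_div_less_iff[of "int T" u q] by (simp add: mult.commute)
    ultimately show "t \<in> {t\<in>{s<..u}. int T dvd t}" using q by auto
  qed
  then have "card {t\<in>{s<..u}. int T dvd t} = card {s div int T<..u div int T}"
    using assms by (simp add: card_image inj_on_def)
  moreover have "s div int T \<le> u div int T" using assms by (intro zdiv_mono1) auto
  ultimately show ?thesis by simp
qed

text \<open>The delay exceeds \<open>D\<close> iff the ceiling times \<open>T\<close> exceeds
  \<open>D - T + i\<close>. The ceiling is an integer, so it is compared with the floor of the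
  quotient, and a ceiling exceeds an integer iff its argument does.\<close>

lemma bit_delay_gt_iff:
  assumes B: "B > 0" and iT: "i < T" "T \<le> D" and q: "q \<noteq> -\<infinity>"
  shows "bit_delay B T i q > ereal (real D) \<longleftrightarrow> q > ereal (real ((D - T + i) div T) * B)"
proof (cases q)
  case (real x)
  let ?m = "(D - T + i) div T"
  have "bit_delay B T i q > ereal (real D) \<longleftrightarrow> real (D - T + i) < real_of_int \<lceil>x / B\<rceil> * real T"
    using iT real by (simp add: bit_delay_def of_nat_diff) linarith
  also have "\<dots> \<longleftrightarrow> real_of_int (int (D - T + i)) < real_of_int (\<lceil>x / B\<rceil> * int T)"
    by simp
  also have "\<dots> \<longleftrightarrow> int (D - T + i) < \<lceil>x / B\<rceil> * int T"
    by (rule of_int_less_iff)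
  also have "\<dots> \<longleftrightarrow> int (D - T + i) div int T < \<lceil>x / B\<rceil>"
    using int_div_less_iff[of "int T" "int (D - T + i)" "\<lceil>x / B\<rceil>"] iT by simp
  also have "\<dots> \<longleftrightarrow> int ?m < \<lceil>x / B\<rceil>" by (simp add: zdiv_int)
  also have "\<dots> \<longleftrightarrow> real ?m < x / B" by (simp add: less_ceiling_iff)
  also have "\<dots> \<longleftrightarrow> real ?m * B < x" using B by (simp add: pos_less_divide_eq)
  finally show ?thesis using real by simp
next
  case PInf
  then show ?thesis by (simp add: bit_delay_def)
qed (use q in simp)

lemma bit_position_not_MInf: "bit_position B T a i j \<noteq> -\<infinity>"
  using queue_nonneg[of B T a "int i - 1"]
  by (cases "queue B T a (int i - 1)") (auto simp: bit_position_def)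

text \<open>With \<open>i = T - 1 - D mod T\<close> these are the positive lengths
  \<open>t * T + i\<close>: such a window ending at slot \<open>i\<close> opens just after the
  removal time \<open>- t * T\<close> and contains exactly \<open>t\<close> removals.\<close>

definition windows :: "nat \<Rightarrow> nat \<Rightarrow> nat set" where
  "windows D T = {n. \<exists>t. n = t * T + T - 1 - D mod T \<and> n > 0}"

text \<open>Lateness gives some window of length \<open>L\<close> whose arrivals exceed
  \<open>(mu + ?m) * ?B\<close>, with \<open>mu\<close> removals inside. Stretching it backwards
  only adds arrivals; the new length \<open>n\<close> is chosen in \<open>windows\<close> so that
  \<open>b * (n + D + 1 - 2 * T)\<close> reproduces the old threshold.\<close>

lemma delay_imp_window:
  assumes T: "1 \<le> T" "2 * T \<le> D" and i: "i < T" and b: "b > 0" and j: "j \<le> a (int i)"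
    and gt: "bit_delay (b * real T) T i (bit_position (b * real T) T a i j) > ereal (real D)"
  shows "\<exists>n\<in>windows D T. (\<Sum>t\<in>{int i - int n<..int i}. real (a t)) > b * (real n + (real D + 1 - 2 * real T))"
proof -
  let ?m = "(D - T + i) div T" and ?B = "b * real T"
  have B: "?B > 0" using b T by simp
  have "ereal (real ?m * ?B) < bit_position ?B T a i j"
    using gt bit_delay_gt_iff[OF B i _ bit_position_not_MInf] T by simp
  also have "\<dots> \<le> bit_position ?B T a i (a (int i))"
    unfolding bit_position_def using j by (intro add_left_mono) simp
  finally obtain L where L: "L \<ge> 1" "net_input ?B T a (int i - int L) (int i) > real ?m * ?B"
    using bit_position_gt_imp_net_input[OF i] by blast
  define mu where "mu = card {t\<in>{int i - int L<..int i}. int T dvd t}"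
  have mu: "int mu = - ((int i - int L) div int T)"
    unfolding mu_def using card_multiples[of T "int i - int L" "int i"] i by simp
  have "(int i - int L) div int T * int T \<le> int i - int L"
    using T by (simp flip: minus_mod_eq_div_mult)
  then have "int L \<le> int mu * int T + int i" using mu by (simp add: algebra_simps)
  \<comment> \<open>With only \<open>mu\<close> removals inside, a window ending at \<open>i\<close>
    cannot open before slot \<open>- mu * T\<close>.\<close>
  then have Lmu: "L \<le> mu * T + i" by (simp flip: of_nat_mult of_nat_add add: zle_int)
  define p k where "p = D div T" and "k = D mod T"
  have D: "D = p * T + k" and k: "k < T" using T by (auto simp: p_def k_def)
  have p2: "p \<ge> 2" using T by (simp add: p_def less_eq_div_iff_mult_less_eq)
  have DT: "D - T = (p - 1) * T + k" using D p2 by (auto simp: algebra_simps diff_mult_distrib)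
  have m: "?m = (if i + k < T then p - 1 else p)"
  proof (cases "i + k < T")
    case True
    then have "((p - 1) * T + (k + i)) div T = p - 1" using T by simp
    then show ?thesis using True DT by (simp add: add.assoc)
  next
    case False
    have "(p - 1) * T + k + i = p * T + (k + i - T)" using False p2 by (cases p) auto
    moreover have "k + i - T < T" using k i by simp
    ultimately have "((p - 1) * T + k + i) div T = p" using T by simp
    then show ?thesis using False DT by simp
  qed
  \<comment> \<open>When \<open>i + k\<close> reaches \<open>T\<close>, the quotient
    \<open>?m\<close> grows by one and so does \<open>t\<close>: thus
    \<open>t + p - 1 = mu + ?m\<close> in both cases, and the length is at least
    \<open>L\<close>.\<close>
  define t where "t = (if i + k < T then mu else mu + 1)"
  define n where "n = t * T + T - 1 - D mod T"
  have nk: "n + k + 1 = t * T + T" using k by (simp add: n_def k_def[symmetric])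
  have nL: "n \<ge> L" using nk Lmu i k by (auto simp: t_def split: if_splits)
  then have nW: "n \<in> windows D T" using L(1) unfolding windows_def n_def by auto
  have thr: "real n + (real D + 1 - 2 * real T) = (real mu + real ?m) * real T"
  proof -
    have "n + D + 1 = (t + 1 + p) * T" using nk D by (simp add: algebra_simps)
    moreover have "t + 1 + p = mu + ?m + 2" using m p2 by (auto simp: t_def)
    ultimately have "n + D + 1 = (mu + ?m + 2) * T" by simp
    then have "real (n + D + 1) = real ((mu + ?m + 2) * T)" by simp
    then show ?thesis by (simp add: algebra_simps)
  qed
  have "(real mu + real ?m) * ?B < (\<Sum>t\<in>{int i - int L<..int i}. real (a t))"
    using L(2) by (simp add: net_input_def mu_def algebra_simps)
  also have "\<dots> \<le> (\<Sum>t\<in>{int i - int n<..int i}. real (a t))"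
    using nL by (intro sum_mono2) auto
  finally show ?thesis using nW thr by (intro bexI[of _ n]) (simp_all add: algebra_simps)
qed

text \<open>For this slot the window contains exactly \<open>t\<close> removals and
  \<open>?m = p - 1\<close>, so the overload threshold coincides with the lateness threshold of the
  last bit and nothing is lost.\<close>

lemma window_imp_delay:
  assumes T: "1 \<le> T" "2 * T \<le> D" and b: "b > 0" and i: "i = T - 1 - D mod T" and n: "n \<in> windows D T"
    and gt: "(\<Sum>t\<in>{int i - int n<..int i}. real (a t)) > b * (real n + (real D + 1 - 2 * real T))"
  shows "bit_delay (b * real T) T i (bit_position (b * real T) T a i (a (int i))) > ereal (real D)"
proof -
  let ?m = "(D - T + i) div T" and ?B = "b * real T"
  have B: "?B > 0" using b T by simp
  have iT: "i < T" using i T by simp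
  define p k where "p = D div T" and "k = D mod T"
  have D: "D = p * T + k" and k: "k < T" using T by (auto simp: p_def k_def)
  have p2: "p \<ge> 2" using T by (simp add: p_def less_eq_div_iff_mult_less_eq)
  have DT: "D - T = (p - 1) * T + k" using D p2 by (auto simp: algebra_simps diff_mult_distrib)
  have ik: "i + k + 1 = T" using i k by (simp add: k_def)
  then have "((p - 1) * T + (k + i)) div T = p - 1" using T by simp
  then have m: "?m = p - 1" using DT by (simp add: add.assoc)
  obtain t where t: "n = t * T + T - 1 - D mod T" "n > 0" using n by (auto simp: windows_def)
  have n_eq: "n = t * T + i" using t(1) ik k by (simp add: k_def[symmetric])
  have "(int i - int n) div int T = - int t" using n_eq T nonzero_mult_div_cancel_right[of "int T" "- int t"] by simp
  then have mu: "card {t\<in>{int i - int n<..int i}. int T dvd t} = t"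
    using card_multiples[of T "int i - int n" "int i"] iT by simp
  have "n + D + 1 = (t + 1 + p) * T" using n_eq ik D by (simp add: algebra_simps)
  then have "n + D + 1 = (t + ?m + 2) * T" using m p2 by simp
  then have "real (n + D + 1) = real ((t + ?m + 2) * T)" by simp
  then have thr: "real n + (real D + 1 - 2 * real T) = (real t + real ?m) * real T"
    by (simp add: algebra_simps)
  have "net_input ?B T a (int i - int n) (int i) > real ?m * ?B"
    using gt unfolding net_input_def mu thr by (simp add: algebra_simps)
  then have "ereal (real ?m * ?B) < bit_position ?B T a i (a (int i))"
    using t(2) by (intro net_input_gt_imp_bit_position[OF iT, of n]) auto
  then show ?thesis
    using bit_delay_gt_iff[OF B iT _ bit_position_not_MInf] T by simp
qed

section \<open>Decay exponents\<close>

lemma eln_ennreal: "eln (ennreal p) = (if p \<le> 0 then -\<infinity> else ereal (ln p))"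
  by (auto simp: eln_def ennreal_eq_0_iff)

lemma eln_less_iff: "eln x < ereal y \<longleftrightarrow> x < ennreal (exp y)"
proof (cases x)
  case (real r)
  have "ln r < y \<longleftrightarrow> r < exp y" if "r > 0"
    using exp_less_cancel_iff[of "ln r" y] that by simp
  with real show ?thesis by (auto simp: eln_ennreal ennreal_less_iff)
qed (simp add: eln_def)

lemma less_eln_iff: "ereal y < eln x \<longleftrightarrow> ennreal (exp y) < x"
proof (cases x)
  case (real r)
  have "y < ln r \<longleftrightarrow> exp y < r" if "r > 0"
    using exp_less_cancel_iff[of y "ln r"] that by simp
  with real show ?thesis by (auto simp: eln_ennreal ennreal_less_iff)
qed (simp add: eln_def)

text \<open>Strict comparison of exponents becomes comparison of reals, including the case of
  vanishing \<open>p\<close>, where the exponent is \<infinity>.\<close>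

lemma exponent_less_iff:
  assumes "s > 0"
  shows "- eln (ennreal p) / ereal s < ereal l \<longleftrightarrow> exp (- l * s) < p"
proof -
  have "- eln (ennreal p) / ereal s < ereal l \<longleftrightarrow> - eln (ennreal p) < ereal (l * s)"
    using assms by (subst ereal_divide_less_iff) (auto simp: mult.commute)
  also have "\<dots> \<longleftrightarrow> ereal (- (l * s)) < eln (ennreal p)"
    using ereal_uminus_less_reorder[of "eln (ennreal p)" "ereal (l * s)"] by simp
  also have "\<dots> \<longleftrightarrow> exp (- l * s) < p"
    by (subst less_eln_iff) (simp add: ennreal_less_iff)
  finally show ?thesis .
qed

lemma less_exponent_iff:
  assumes "s > 0"
  shows "ereal l < - eln (ennreal p) / ereal s \<longleftrightarrow> p < exp (- l * s)"
proof -
  have "ereal l < - eln (ennreal p) / ereal s \<longleftrightarrow> ereal (l * s) < - eln (ennreal p)"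
    using assms by (subst ereal_less_divide_iff) (auto simp: mult.commute)
  also have "\<dots> \<longleftrightarrow> eln (ennreal p) < ereal (- (l * s))"
    using ereal_less_uminus_reorder[of "ereal (l * s)" "eln (ennreal p)"] by simp
  also have "\<dots> \<longleftrightarrow> p < exp (- l * s)"
    by (subst eln_less_iff) (cases "p \<ge> 0"; use less_trans[of p 0 "exp (- l * s)"] in \<open>simp add: ennreal_less_iff ennreal_neg\<close>)
  finally show ?thesis .
qed

text \<open>One-sided eventual bounds with real exponents behave well under sums and changes of
  speed, even when the limit in \<open>decay_exponent\<close> is infinite or does not exist.\<close>

definition decays_at_least :: "(nat \<Rightarrow> real) \<Rightarrow> (nat \<Rightarrow> real) \<Rightarrow> real \<Rightarrow> bool" where
  "decays_at_least p s l \<longleftrightarrow> (\<forall>\<^sub>F N in sequentially. p N \<le> exp (- l * s N))"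

definition decays_at_most :: "(nat \<Rightarrow> real) \<Rightarrow> (nat \<Rightarrow> real) \<Rightarrow> real \<Rightarrow> bool" where
  "decays_at_most p s l \<longleftrightarrow> (\<forall>\<^sub>F N in sequentially. exp (- l * s N) \<le> p N)"

lemma decay_exponentI:
  assumes s: "filterlim s at_top sequentially"
    and ub: "\<And>l. ereal l < L \<Longrightarrow> decays_at_least p s l"
    and lb: "\<And>l. L < ereal l \<Longrightarrow> decays_at_most p s l"
  shows "decay_exponent p s L"
  unfolding decay_exponent_def
proof (rule order_tendstoI)
  have pos: "\<forall>\<^sub>F N in sequentially. 0 < s N"
    using s by (simp add: filterlim_at_top_dense)
  {
    fix l assume "l < L"
    \<comment> \<open>Two intermediate exponents: one is a real bound, the other turns the weak
      eventual inequality into the strict one that the comparison of exponents requires.\<close>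
    then obtain l1 where l1: "l < ereal l1" "ereal l1 < L" by (metis ereal_dense2)
    obtain l2 where l2: "ereal l1 < ereal l2" "ereal l2 < L" using ereal_dense2[OF l1(2)] by auto
    show "\<forall>\<^sub>F N in sequentially. l < - eln (ennreal (p N)) / ereal (s N)"
      using pos ub[OF l2(2), unfolded decays_at_least_def]
    proof eventually_elim
      case (elim N)
      have "exp (- l2 * s N) < exp (- l1 * s N)" using l2 elim by simp
      with elim have "ereal l1 < - eln (ennreal (p N)) / ereal (s N)"
        by (subst less_exponent_iff) linarith+
      with l1(1) show ?case by (rule less_trans)
    qed
  next
    fix l assume "L < l"
    then obtain l1 where l1: "L < ereal l1" "ereal l1 < l" by (metis ereal_dense2)
    obtain l2 where l2: "L < ereal l2" "ereal l2 < ereal l1" using ereal_dense2[OF l1(1)] by auto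
    show "\<forall>\<^sub>F N in sequentially. - eln (ennreal (p N)) / ereal (s N) < l"
      using pos lb[OF l2(1), unfolded decays_at_most_def]
    proof eventually_elim
      case (elim N)
      have "exp (- l1 * s N) < exp (- l2 * s N)" using l2 elim by simp
      with elim have "- eln (ennreal (p N)) / ereal (s N) < ereal l1"
        by (subst exponent_less_iff) linarith+
      then show ?case using l1(2) by (rule less_trans)
    qed
  }
qed

lemma decay_exponent_le:
  assumes s: "filterlim s at_top sequentially" and L: "decay_exponent p s L"
    and lb: "decays_at_most p s l"
  shows "L \<le> ereal l"
proof (rule tendsto_upperbound[OF L[unfolded decay_exponent_def]])
  have "\<forall>\<^sub>F N in sequentially. 0 < s N"
    using s by (simp add: filterlim_at_top_dense)
  then show "\<forall>\<^sub>F N in sequentially. - eln (ennreal (p N)) / ereal (s N) \<le> ereal l"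
    using lb[unfolded decays_at_most_def]
  proof eventually_elim
    case (elim N)
    then have "\<not> ereal l < - eln (ennreal (p N)) / ereal (s N)"
      using less_exponent_iff[of "s N" l "p N"] by linarith
    then show ?case by (simp only: not_less)
  qed
qed simp

section \<open>Large deviations of the arrivals\<close>

locale smooth_source =
  fixes g :: "real \<Rightarrow> real" and lam :: real and M :: "nat \<Rightarrow> 'a measure"
    and A :: "nat \<Rightarrow> int \<Rightarrow> 'a \<Rightarrow> nat" and \<Lambda> :: "real \<Rightarrow> ereal"
  assumes scaling: "scaling_function g" and lam_pos: "0 < lam"
    and source: "smoothly_scaling_source g lam M A \<Lambda>"
begin

abbreviation G :: "nat \<Rightarrow> real" where "G N \<equiv> g (real N)"

definition mgf :: "nat \<Rightarrow> real \<Rightarrow> ennreal" where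
  "mgf N \<theta> = (\<integral>\<^sup>+ \<omega>. ennreal (exp (\<theta> * G N / real N * real (A N 1 \<omega>))) \<partial>M N)"

lemma G_pos: "N \<ge> 1 \<Longrightarrow> G N > 0"
  using scaling by (simp add: scaling_function_def)

lemma prob_space_M: "N \<ge> 1 \<Longrightarrow> prob_space (M N)"
  using source unfolding smoothly_scaling_source_def by blast

lemma indep_A: "N \<ge> 1 \<Longrightarrow> prob_space.indep_vars (M N) (\<lambda>_. count_space UNIV) (A N) UNIV"
  using source unfolding smoothly_scaling_source_def by blast

lemma measurable_A:
  assumes "N \<ge> 1"
  shows "A N t \<in> measurable (M N) (count_space UNIV)"
proof -
  interpret prob_space "M N" by (rule prob_space_M[OF assms])
  show ?thesis using indep_A[OF assms] unfolding indep_vars_def by blast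
qed

lemma distr_A:
  "N \<ge> 1 \<Longrightarrow> distr (M N) (count_space UNIV) (A N t) = distr (M N) (count_space UNIV) (A N 1)"
  using source unfolding smoothly_scaling_source_def by blast

lemma mean_A:
  "N \<ge> 1 \<Longrightarrow> integrable (M N) (\<lambda>\<omega>. real (A N t \<omega>))"
  "N \<ge> 1 \<Longrightarrow> (LINT \<omega>|M N. real (A N t \<omega>)) = lam * real N"
  using source unfolding smoothly_scaling_source_def by blast+

lemma mgf_tendsto: "(\<lambda>N. eln (mgf N \<theta>) / ereal (G N)) \<longlonglongrightarrow> \<Lambda> \<theta>"
  using source unfolding smoothly_scaling_source_def mgf_def by blast

lemma \<Lambda>_not_MInf: "\<Lambda> \<theta> \<noteq> -\<infinity>"
  using source unfolding smoothly_scaling_source_def by blast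

lemma eventually_ge_1: "\<forall>\<^sub>F N in sequentially. N \<ge> (1::nat)"
  by (rule eventually_ge_at_top)

text \<open>Superlogarithmic growth of \<open>g\<close>: an arbitrarily small loss of exponent at
  speed \<open>G\<close> pays for a linear prefactor, such as the number of bits in a slot.\<close>

lemma linear_le_exp_G:
  assumes "e > 0"
  shows "\<forall>\<^sub>F N in sequentially. K * real N \<le> exp (e * G N)"
proof -
  have "filterlim (\<lambda>N. G N / ln (real N)) at_top sequentially"
    using scaling filterlim_compose[OF _ filterlim_real_sequentially]
    unfolding scaling_function_def by blast
  \<comment> \<open>The constant 2 puts \<open>N * N\<close> below \<open>exp (e * G N)\<close>; one
    of the factors \<open>N\<close> absorbs \<open>K\<close>.\<close>
  then have "\<forall>\<^sub>F N in sequentially. G N / ln (real N) \<ge> 2 / e"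
    by (simp add: filterlim_at_top)
  moreover have "\<forall>\<^sub>F N in sequentially. real N \<ge> max 2 K"
    using filterlim_real_sequentially unfolding filterlim_at_top by blast
  ultimately show ?thesis
  proof eventually_elim
    case (elim N)
    then have N: "real N > 1" "K \<le> real N" by auto
    then have "ln (real N) > 0" by simp
    then have "2 * ln (real N) \<le> e * G N" using elim(1) assms by (simp add: field_simps)
    then have "exp (ln (real N) + ln (real N)) \<le> exp (e * G N)" by simp
    moreover have "exp (ln (real N) + ln (real N)) = real N * real N"
      using N by (subst exp_add) simp
    moreover have "K * real N \<le> real N * real N" using N by (intro mult_right_mono) auto
    ultimately show ?case by linarith
  qed
qed

lemma const_le_exp_G:
  assumes "e > 0"
  shows "\<forall>\<^sub>F N in sequentially. K \<le> exp (e * G N)"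
  using linear_le_exp_G[OF assms, of "\<bar>K\<bar>"] eventually_ge_1
proof eventually_elim
  case (elim N)
  have "K \<le> \<bar>K\<bar> * 1" by simp
  also have "\<dots> \<le> \<bar>K\<bar> * real N" using elim by (intro mult_left_mono) auto
  finally show ?case using elim by simp
qed

lemma G_at_top: "filterlim G at_top sequentially"
  unfolding filterlim_at_top
proof
  fix Z
  show "\<forall>\<^sub>F N in sequentially. Z \<le> G N"
    using const_le_exp_G[of 1 "exp Z"] by simp
qed

lemma mgf_less:
  assumes "\<Lambda> \<theta> < ereal l"
  shows "\<forall>\<^sub>F N in sequentially. mgf N \<theta> < ennreal (exp (l * G N))"
  using order_tendstoD(2)[OF mgf_tendsto assms] eventually_ge_1
proof eventually_elim
  case (elim N)
  then have "eln (mgf N \<theta>) < ereal (l * G N)"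
    using G_pos[of N] by (subst (asm) ereal_divide_less_iff) (auto simp: mult.commute)
  then show ?case by (simp only: eln_less_iff)
qed

lemma mgf_greater:
  assumes "ereal l < \<Lambda> \<theta>"
  shows "\<forall>\<^sub>F N in sequentially. ennreal (exp (l * G N)) < mgf N \<theta>"
  using order_tendstoD(1)[OF mgf_tendsto assms] eventually_ge_1
proof eventually_elim
  case (elim N)
  then have "ereal (l * G N) < eln (mgf N \<theta>)"
    using G_pos[of N] by (subst (asm) ereal_less_divide_iff) (auto simp: mult.commute)
  then show ?case by (simp only: less_eln_iff)
qed

lemma nn_integral_A:
  assumes "N \<ge> 1"
  shows "(\<integral>\<^sup>+ \<omega>. f (A N t \<omega>) \<partial>M N) = (\<integral>\<^sup>+ \<omega>. f (A N 1 \<omega>) \<partial>M N)"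
proof -
  have "(\<integral>\<^sup>+ \<omega>. f (A N t \<omega>) \<partial>M N) = (\<integral>\<^sup>+ x. f x \<partial>distr (M N) (count_space UNIV) (A N t))"
    using measurable_A[OF assms] by (subst nn_integral_distr) auto
  also have "\<dots> = (\<integral>\<^sup>+ \<omega>. f (A N 1 \<omega>) \<partial>M N)"
    using measurable_A[OF assms] by (subst distr_A[OF assms], subst nn_integral_distr) auto
  finally show ?thesis .
qed

lemma measure_A:
  assumes "N \<ge> 1"
  shows "measure (M N) {\<omega>\<in>space (M N). A N t \<omega> \<in> S} = measure (M N) {\<omega>\<in>space (M N). A N 1 \<omega> \<in> S}"
proof -
  have "measure (M N) {\<omega>\<in>space (M N). A N t \<omega> \<in> S} = measure (distr (M N) (count_space UNIV) (A N t)) S" for t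
    using measurable_A[OF assms] by (subst measure_distr) (auto intro!: arg_cong[of _ _ "measure (M N)"])
  then show ?thesis using distr_A[OF assms, of t] by simp
qed

text \<open>Markov's inequality for the exponentially tilted sum; independence turns its generating
  function into a power of \<open>mgf\<close>. The tilt \<open>\<theta> * G N / N\<close> makes the
  level \<open>N * c\<close> contribute \<open>\<theta> * c\<close> at speed
  \<open>G N\<close>.\<close>

lemma chernoff:
  assumes N: "N \<ge> 1" and \<theta>: "\<theta> \<ge> 0" and J: "finite J" and l: "mgf N \<theta> \<le> ennreal (exp (l * G N))"
  shows "measure (M N) {\<omega>\<in>space (M N). real N * c < (\<Sum>t\<in>J. real (A N t \<omega>))}
    \<le> exp (- G N * (\<theta> * c - real (card J) * l))"
proof -
  interpret prob_space "M N" by (rule prob_space_M[OF N])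
  have meas [measurable]: "A N t \<in> measurable (M N) (count_space UNIV)" for t
    by (rule measurable_A[OF N])
  define h where "h = \<theta> * G N / real N"
  have h: "h \<ge> 0" using \<theta> G_pos[OF N] by (simp add: h_def)
  let ?E = "{\<omega>\<in>space (M N). real N * c < (\<Sum>t\<in>J. real (A N t \<omega>))}"
  have "emeasure (M N) ?E = (\<integral>\<^sup>+ \<omega>. indicator ?E \<omega> \<partial>M N)" by simp
  also have "\<dots> \<le> (\<integral>\<^sup>+ \<omega>. ennreal (exp (- G N * \<theta> * c)) * (\<Prod>t\<in>J. ennreal (exp (h * real (A N t \<omega>)))) \<partial>M N)"
  proof (rule nn_integral_mono)
    fix \<omega> assume "\<omega> \<in> space (M N)"
    have eq: "ennreal (exp (- G N * \<theta> * c)) * (\<Prod>t\<in>J. ennreal (exp (h * real (A N t \<omega>)))) =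
        ennreal (exp (h * ((\<Sum>t\<in>J. real (A N t \<omega>)) - real N * c)))"
    proof -
      have "h * (real N * c) = G N * \<theta> * c" using N by (simp add: h_def)
      then show ?thesis using J
        by (simp add: eq_commute[of "G N * \<theta>"] prod_ennreal ennreal_mult[symmetric] exp_sum[symmetric]
            exp_add[symmetric] sum_distrib_left[symmetric] right_diff_distrib)
    qed
    have "ennreal 1 \<le> ennreal (exp (h * ((\<Sum>t\<in>J. real (A N t \<omega>)) - real N * c)))" if "\<omega> \<in> ?E"
      using that h by (intro ennreal_leI) (simp add: mult_nonneg_nonneg)
    then show "indicator ?E \<omega> \<le> ennreal (exp (- G N * \<theta> * c)) * (\<Prod>t\<in>J. ennreal (exp (h * real (A N t \<omega>))))"
      unfolding eq by (auto simp: indicator_def)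
  qed
  also have "\<dots> = ennreal (exp (- G N * \<theta> * c)) * (\<integral>\<^sup>+ \<omega>. (\<Prod>t\<in>J. ennreal (exp (h * real (A N t \<omega>)))) \<partial>M N)"
    by (rule nn_integral_cmult) measurable
  also have "(\<integral>\<^sup>+ \<omega>. (\<Prod>t\<in>J. ennreal (exp (h * real (A N t \<omega>)))) \<partial>M N) =
      (\<Prod>t\<in>J. \<integral>\<^sup>+ \<omega>. ennreal (exp (h * real (A N t \<omega>))) \<partial>M N)"
  proof (rule indep_vars_nn_integral[OF J])
    show "indep_vars (\<lambda>_. borel) (\<lambda>t \<omega>. ennreal (exp (h * real (A N t \<omega>)))) J"
      by (rule indep_vars_compose2[OF indep_vars_subset[OF indep_A[OF N]]]) auto
  qed simp
  also have "\<dots> = mgf N \<theta> ^ card J"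
  proof -
    have "(\<integral>\<^sup>+ \<omega>. ennreal (exp (h * real (A N t \<omega>))) \<partial>M N) = mgf N \<theta>" for t
      by (subst nn_integral_A[OF N, of "\<lambda>k. ennreal (exp (h * real k))"]) (simp add: mgf_def h_def)
    then show ?thesis by simp
  qed
  also have "ennreal (exp (- G N * \<theta> * c)) * mgf N \<theta> ^ card J \<le>
      ennreal (exp (- G N * \<theta> * c)) * ennreal (exp (l * G N)) ^ card J"
    by (intro mult_left_mono power_mono l) auto
  also have "\<dots> = ennreal (exp (- G N * (\<theta> * c - real (card J) * l)))"
    by (simp add: ennreal_power ennreal_mult[symmetric] exp_of_nat_mult[symmetric]
        exp_add[symmetric] algebra_simps)
  finally show ?thesis by (simp add: emeasure_eq_measure)
qed

section \<open>The limiting generating function: mean bound, domain and slope\<close>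

lemma \<Lambda>_zero: "\<Lambda> 0 = 0"
proof -
  have "eln (mgf N 0) / ereal (G N) = 0" if "N \<ge> 1" for N
  proof -
    interpret prob_space "M N" by (rule prob_space_M[OF that])
    show ?thesis using G_pos[OF that] emeasure_space_1 by (simp add: mgf_def eln_def)
  qed
  then have "\<forall>\<^sub>F N in sequentially. eln (mgf N 0) / ereal (G N) = 0"
    using eventually_ge_1 by (rule eventually_mono[rotated])
  then have "(\<lambda>N. eln (mgf N 0) / ereal (G N)) \<longlonglongrightarrow> 0" by (rule tendsto_eventually)
  with mgf_tendsto show ?thesis by (rule LIMSEQ_unique)
qed

text \<open>Jensen's inequality for each \<open>N\<close>, obtained by integrating the tangent of
  \<open>exp\<close> at the mean exponent, then passed to the limit.\<close>

lemma \<Lambda>_ge_mean: "ereal (\<theta> * lam) \<le> \<Lambda> \<theta>"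
proof (rule tendsto_lowerbound[OF mgf_tendsto])
  show "\<forall>\<^sub>F N in sequentially. ereal (\<theta> * lam) \<le> eln (mgf N \<theta>) / ereal (G N)"
    using eventually_ge_1
  proof eventually_elim
    case (elim N)
    interpret prob_space "M N" by (rule prob_space_M[OF elim])
    define h where "h = \<theta> * G N / real N"
    let ?X = "\<lambda>\<omega>. h * real (A N 1 \<omega>)" and ?m = "\<theta> * G N * lam"
    have [measurable]: "A N 1 \<in> measurable (M N) (count_space UNIV)" by (rule measurable_A[OF elim])
    have "ennreal (exp ?m) \<le> mgf N \<theta>"
    proof (cases "mgf N \<theta> = \<infinity>")
      case False
      have int: "integrable (M N) (\<lambda>\<omega>. exp (?X \<omega>))"
        using False by (intro integrableI_bounded) (auto simp: mgf_def h_def top.not_eq_extremum)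
      have "exp ?m * (1 + ?X \<omega> - ?m) \<le> exp (?X \<omega>)" for \<omega>
      proof -
        have "exp ?m * (1 + (?X \<omega> - ?m)) \<le> exp ?m * exp (?X \<omega> - ?m)"
          by (intro mult_left_mono exp_ge_add_one_self) simp
        then show ?thesis by (simp add: exp_add[symmetric] add_diff_eq)
      qed
      then have "(LINT \<omega>|M N. exp ?m * (1 + ?X \<omega> - ?m)) \<le> (LINT \<omega>|M N. exp (?X \<omega>))"
        using mean_A(1)[OF elim] int by (intro integral_mono) auto
      moreover have "(LINT \<omega>|M N. exp ?m * (1 + ?X \<omega> - ?m)) = exp ?m"
        using mean_A[OF elim, of 1] elim by (simp add: prob_space h_def)
      ultimately have "ennreal (exp ?m) \<le> ennreal (LINT \<omega>|M N. exp (?X \<omega>))"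
        by (simp add: ennreal_leI)
      also have "\<dots> = mgf N \<theta>"
        using int by (simp add: nn_integral_eq_integral mgf_def h_def)
      finally show ?thesis .
    qed simp
    then have "ereal ?m \<le> eln (mgf N \<theta>)"
      using eln_less_iff[of "mgf N \<theta>" ?m] by (metis not_less)
    then show ?case
      using G_pos[OF elim] by (simp add: ereal_le_divide_pos mult.commute mult.left_commute mult.assoc)
  qed
qed simp

abbreviation F :: "real \<Rightarrow> real" where "F \<theta> \<equiv> real_of_ereal (\<Lambda> \<theta>)"

abbreviation rate :: "real \<Rightarrow> ereal" where "rate \<equiv> convex_conjugate \<Lambda>"

text \<open>Bit counts are nonnegative, so \<open>mgf N\<close> increases in the slope. Hence the
  effective domain is closed downwards.\<close>

lemma mono_\<Lambda>: "\<theta> \<le> \<theta>' \<Longrightarrow> \<Lambda> \<theta> \<le> \<Lambda> \<theta>'"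
proof (rule ccontr)
  assume le: "\<theta> \<le> \<theta>'" and "\<not> \<Lambda> \<theta> \<le> \<Lambda> \<theta>'"
  then obtain l where l: "\<Lambda> \<theta>' < ereal l" "ereal l < \<Lambda> \<theta>"
    by (meson ereal_dense2 not_le)
  have "\<forall>\<^sub>F N in sequentially. False"
    using mgf_less[OF l(1)] mgf_greater[OF l(2)] eventually_ge_1
  proof eventually_elim
    case (elim N)
    have "mgf N \<theta> \<le> mgf N \<theta>'"
      unfolding mgf_def using le G_pos[OF elim(3)]
      by (intro nn_integral_mono ennreal_leI) (auto intro!: mult_right_mono divide_right_mono)
    with elim show ?case by (meson less_trans not_le)
  qed
  then show False by simp
qed

lemma finite_below: "\<theta> \<le> \<theta>' \<Longrightarrow> \<Lambda> \<theta>' < \<infinity> \<Longrightarrow> \<Lambda> \<theta> < \<infinity>"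
  by (rule le_less_trans[OF mono_\<Lambda>])

lemma \<Lambda>_eq_F: "\<Lambda> \<theta> < \<infinity> \<Longrightarrow> \<Lambda> \<theta> = ereal (F \<theta>)"
  using \<Lambda>_not_MInf[of \<theta>] by (cases "\<Lambda> \<theta>") auto

lemma F_ge_mean: "\<Lambda> \<theta> < \<infinity> \<Longrightarrow> \<theta> * lam \<le> F \<theta>"
  using \<Lambda>_ge_mean[of \<theta>] \<Lambda>_eq_F[of \<theta>] by (metis ereal_less_eq(3))

lemma F_zero: "F 0 = 0"
  by (simp add: \<Lambda>_zero)

lemma interior_domainI:
  assumes "\<Lambda> b < \<infinity>" "\<theta> < b"
  shows "\<theta> \<in> interior (effective_domain \<Lambda>)"
proof -
  have "{..<b} \<subseteq> effective_domain \<Lambda>"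
  proof
    fix t assume "t \<in> {..<b}"
    then show "t \<in> effective_domain \<Lambda>" using finite_below[of t b] assms(1) by (simp add: effective_domain_def)
  qed
  then have "{..<b} \<subseteq> interior (effective_domain \<Lambda>)" by (intro interior_maximal) auto
  then show ?thesis using assms(2) by auto
qed

lemma interior_domain_gt:
  assumes "\<theta> \<in> interior (effective_domain \<Lambda>)"
  obtains b where "\<theta> < b" "\<Lambda> b < \<infinity>"
proof -
  obtain e where e: "e > 0" "ball \<theta> e \<subseteq> effective_domain \<Lambda>"
    using assms by (auto simp: mem_interior)
  have "\<theta> + e / 2 \<in> ball \<theta> e" using e by (simp add: dist_real_def)
  then have "\<Lambda> (\<theta> + e / 2) < \<infinity>" using e by (auto simp: effective_domain_def)
  then show ?thesis using e by (intro that[of "\<theta> + e / 2"]) auto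
qed

lemma positive_domain: obtains b where "0 < b" "\<Lambda> b < \<infinity>"
proof -
  have "\<forall>\<^sub>F \<theta> in nhds 0. \<Lambda> \<theta> < \<infinity>"
    using source unfolding smoothly_scaling_source_def by blast
  then obtain d where d: "d > 0" "\<And>x. dist x 0 < d \<Longrightarrow> \<Lambda> x < \<infinity>"
    by (auto simp: eventually_nhds_metric)
  then show ?thesis using that[of "d / 2"] by (simp add: dist_real_def)
qed

lemma interior_domain_le: 
  "\<theta> \<in> interior (effective_domain \<Lambda>) \<Longrightarrow> \<theta>' \<le> \<theta> \<Longrightarrow> \<theta>' \<in> interior (effective_domain \<Lambda>)"
  by (metis interior_domainI interior_domain_gt le_less_trans)

lemma zero_interior: "0 \<in> interior (effective_domain \<Lambda>)"
  by (metis positive_domain interior_domainI)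

lemma DERIV_F:
  assumes "\<theta> \<in> interior (effective_domain \<Lambda>)"
  shows "(F has_real_derivative deriv F \<theta>) (at \<theta>)"
proof -
  have "F differentiable (at \<theta>)"
    using source assms unfolding smoothly_scaling_source_def essentially_smooth_def Let_def by blast
  then show ?thesis by (simp add: DERIV_deriv_iff_real_differentiable)
qed

lemma deriv_F_nonneg:
  assumes "\<theta> \<in> interior (effective_domain \<Lambda>)"
  shows "deriv F \<theta> \<ge> 0"
proof (rule ccontr)
  assume "\<not> deriv F \<theta> \<ge> 0"
  then obtain d where d: "d > 0" "\<And>h. h > 0 \<Longrightarrow> h < d \<Longrightarrow> F \<theta> > F (\<theta> + h)"
    using DERIV_neg_dec_right[OF DERIV_F[OF assms]] by auto
  obtain b where b: "\<theta> < b" "\<Lambda> b < \<infinity>" by (rule interior_domain_gt[OF assms])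
  define h where "h = min (d / 2) (b - \<theta>)"
  have h: "h > 0" "h < d" "\<theta> + h \<le> b" using d(1) b by (auto simp: h_def)
  have "\<Lambda> (\<theta> + h) < \<infinity>" using h(3) b(2) by (rule finite_below)
  moreover have "\<Lambda> \<theta> \<le> \<Lambda> (\<theta> + h)" using h by (intro mono_\<Lambda>) simp
  ultimately have "F \<theta> \<le> F (\<theta> + h)"
    using \<Lambda>_eq_F[of "\<theta> + h"] \<Lambda>_eq_F[of \<theta>] by (metis ereal_less_eq(3) le_less_trans)
  with d(2)[OF h(1,2)] show False by simp
qed

text \<open>By the mean bound, \<open>F \<theta> - lam * \<theta>\<close> is nonnegative where
  \<Lambda> is finite and vanishes at 0, which is thus a local minimum.\<close>

lemma deriv_F_zero: "deriv F 0 = lam"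
proof -
  obtain b where b: "0 < b" "\<Lambda> b < \<infinity>" by (rule positive_domain)
  have "((\<lambda>\<theta>. F \<theta> - lam * \<theta>) has_real_derivative (deriv F 0 - lam)) (at 0)"
    by (auto intro!: derivative_eq_intros DERIV_F[OF zero_interior])
  moreover have "\<forall>y. \<bar>0 - y\<bar> < b \<longrightarrow> F 0 - lam * 0 \<le> F y - lam * y"
  proof (intro allI impI)
    fix y assume "\<bar>0 - y\<bar> < b"
    then have "\<Lambda> y < \<infinity>" using finite_below[of y b] b(2) by auto
    then show "F 0 - lam * 0 \<le> F y - lam * y" using F_ge_mean[of y] F_zero by (simp add: mult.commute)
  qed
  ultimately have "deriv F 0 - lam = 0" by (rule DERIV_local_min[OF _ b(1)])
  then show ?thesis by simp
qed

text \<open>\<open>F\<close> starts at 0 with slope \<open>lam < r\<close>, so it drops strictly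
  below the line of slope \<open>r\<close>. The margin \<open>\<delta>\<close> is the exponent
  gained per slot at load \<open>r\<close>; it controls the long windows.\<close>

lemma exponent_above_mean:
  assumes "lam < r"
  obtains \<theta> \<delta> where "\<theta> > 0" "\<delta> > 0" "\<Lambda> \<theta> < ereal (\<theta> * r - \<delta>)"
proof -
  have "((\<lambda>\<theta>. F \<theta> - r * \<theta>) has_real_derivative (lam - r)) (at 0)"
    using DERIV_F[OF zero_interior] by (auto intro!: derivative_eq_intros simp: deriv_F_zero)
  from DERIV_neg_dec_right[OF this] assms obtain d where
    d: "d > 0" "\<And>h. h > 0 \<Longrightarrow> h < d \<Longrightarrow> F h - r * h < 0" by (auto simp: \<Lambda>_zero)
  obtain b where b: "0 < b" "\<Lambda> b < \<infinity>" by (rule positive_domain)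
  define h where "h = min (d / 2) b"
  have h: "h > 0" "h < d" "h \<le> b" using d(1) b by (auto simp: h_def)
  have "\<Lambda> h < \<infinity>" using h(3) b(2) by (rule finite_below)
  moreover have "F h < h * r - (h * r - F h) / 2" using d(2)[OF h(1,2)] by (simp add: field_simps)
  ultimately have "\<Lambda> h < ereal (h * r - (h * r - F h) / 2)"
    by (metis \<Lambda>_eq_F less_ereal.simps(1))
  moreover have "(h * r - F h) / 2 > 0" using d(2)[OF h(1,2)] by (simp add: mult.commute)
  ultimately show ?thesis using h(1) that by blast
qed

section \<open>The convex conjugate above the mean, and slopes exposing its points\<close>

lemma rate_ge: "ereal (\<theta> * x) - \<Lambda> \<theta> \<le> rate x"
  unfolding convex_conjugate_def by (rule SUP_upper) simp

lemma rate_nonneg: "0 \<le> rate x"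
  using rate_ge[of 0 x] by (simp add: \<Lambda>_zero zero_ereal_def)

text \<open>Convexity between \<open>lam\<close> and \<open>y\<close>, checked slope by slope: each
  affine function \<open>\<theta> * x - F \<theta>\<close> of \<open>x\<close> is nonpositive at
  \<open>lam\<close> by the mean bound.\<close>

lemma rate_le_scaled:
  assumes "lam < x" "x \<le> y"
  shows "rate x \<le> ereal ((x - lam) / (y - lam)) * rate y"
  unfolding convex_conjugate_def[of \<Lambda> x]
proof (rule SUP_least)
  fix \<theta>
  define t where "t = (x - lam) / (y - lam)"
  have t: "0 \<le> t" "t \<le> 1" "t * (y - lam) = x - lam" using assms by (auto simp: t_def)
  show "ereal (\<theta> * x) - \<Lambda> \<theta> \<le> ereal ((x - lam) / (y - lam)) * rate y"
  proof (cases "\<Lambda> \<theta> < \<infinity>")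
    case True
    obtain f where eq: "\<Lambda> \<theta> = ereal f" and f: "\<theta> * lam \<le> f"
      using \<Lambda>_eq_F[OF True] F_ge_mean[OF True] by blast
    have "x = t * y + (1 - t) * lam" using t(3) unfolding left_diff_distrib right_diff_distrib by linarith
    from arg_cong[OF this, of "(*) \<theta>"] have "\<theta> * x - f = t * (\<theta> * y - f) - (1 - t) * (f - \<theta> * lam)"
      by (simp add: algebra_simps)
    moreover have "(1 - t) * (f - \<theta> * lam) \<ge> 0"
      using t f by (intro mult_nonneg_nonneg) auto
    ultimately have "ereal (\<theta> * x) - \<Lambda> \<theta> \<le> ereal t * (ereal (\<theta> * y) - \<Lambda> \<theta>)"
      unfolding eq by simp
    also have "\<dots> \<le> ereal t * rate y"
      using t by (intro ereal_mult_left_mono rate_ge) simp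
    finally show ?thesis by (simp only: t_def)
  qed simp
qed

text \<open>A Chernoff bound for an upper tail needs a nonnegative slope. Above the mean, negative
  slopes yield only nonpositive values and cannot beat \<open>l \<ge> 0\<close>.\<close>

lemma less_rate_exponent:
  assumes "lam < x" "0 \<le> l" "ereal l < rate x"
  obtains \<theta> where "\<theta> \<ge> 0" "\<Lambda> \<theta> < ereal (\<theta> * x - l)"
proof -
  obtain \<theta> where \<theta>: "ereal l < ereal (\<theta> * x) - \<Lambda> \<theta>"
    using assms(3) unfolding convex_conjugate_def less_SUP_iff by blast
  then have fin: "\<Lambda> \<theta> < \<infinity>" by auto
  note eq = \<Lambda>_eq_F[OF fin]
  have l: "l < \<theta> * x - F \<theta>" using \<theta> by (subst (asm) eq) simp
  have "\<theta> \<ge> 0"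
  proof (rule ccontr)
    assume "\<not> \<theta> \<ge> 0"
    then have "\<theta> * x \<le> \<theta> * lam" using assms(1) by (intro mult_left_mono_neg) auto
    with l F_ge_mean[OF fin] assms(2) show False by simp
  qed
  moreover have "\<Lambda> \<theta> < ereal (\<theta> * x - l)" by (subst eq) (use l in simp)
  ultimately show ?thesis by (rule that)
qed

text \<open>If \<Lambda> is finite everywhere, bounded slopes would make
  \<open>\<theta> * y - F \<theta>\<close> unbounded, against \<open>rate y < \<infinity>\<close>.
  Otherwise the domain has a right end, where essential smoothness makes the slopes blow up.\<close>

lemma steep:
  assumes fin: "rate y < \<infinity>" and y: "lam < y'" "y' < y"
  obtains \<theta> where "\<theta> > 0" "\<theta> \<in> interior (effective_domain \<Lambda>)" "deriv F \<theta> > y'"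
proof (cases "\<forall>\<theta>. \<Lambda> \<theta> < \<infinity>")
  case True
  then have int: "\<theta> \<in> interior (effective_domain \<Lambda>)" for \<theta>
    by (simp add: effective_domain_def)
  have "\<exists>\<theta>>0. deriv F \<theta> > y'"
  proof (rule ccontr)
    assume "\<not> ?thesis"
    then have le: "deriv F \<theta> \<le> y'" if "\<theta> > 0" for \<theta> using that by force
    have Fle: "F \<theta> \<le> \<theta> * y'" if pos: "\<theta> > 0" for \<theta>
    proof -
      obtain z where z: "0 < z" "z < \<theta>" "F \<theta> - F 0 = (\<theta> - 0) * deriv F z"
        using MVT2[OF pos, of F "deriv F"] DERIV_F[OF int] by blast
      then show ?thesis using le[OF z(1)] pos F_zero by (simp add: mult_left_mono)
    qed
    obtain c where c: "rate y = ereal c" "c \<ge> 0"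
      using fin rate_nonneg[of y] by (cases "rate y") auto
    \<comment> \<open>Chosen so that the gain \<open>\<theta> * (y - y')\<close> equals
      \<open>c + 1\<close>, more than \<open>rate y\<close> allows.\<close>
    define \<theta> where "\<theta> = (c + 1) / (y - y')"
    have \<theta>: "\<theta> > 0" using c y by (simp add: \<theta>_def)
    have "ereal (\<theta> * y) - \<Lambda> \<theta> \<le> ereal c" using rate_ge[of \<theta> y] c by simp
    then have "\<theta> * y - F \<theta> \<le> c" by (subst (asm) \<Lambda>_eq_F) (use True in auto)
    then have "\<theta> * (y - y') \<le> c" using Fle[OF \<theta>] by (simp add: algebra_simps)
    then show False using y by (simp add: \<theta>_def)
  qed
  then show ?thesis using that int by blast
next
  case False
  then obtain u where u: "\<not> \<Lambda> u < \<infinity>" by blast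
  let ?S = "effective_domain \<Lambda>"
  have below: "\<theta> < u" if "\<theta> \<in> ?S" for \<theta>
    using that u finite_below[of u \<theta>] unfolding effective_domain_def mem_Collect_eq by (meson not_le)
  then have bdd: "bdd_above ?S" by (meson bdd_aboveI less_imp_le)
  define b where "b = Sup ?S"
  obtain b0 where b0: "0 < b0" "\<Lambda> b0 < \<infinity>" by (rule positive_domain)
  then have ne: "?S \<noteq> {}" by (auto simp: effective_domain_def)
  have "b0 \<le> b" unfolding b_def using b0 by (intro cSup_upper bdd) (simp add: effective_domain_def)
  with b0 have b: "b > 0" by simp
  have int: "\<theta> \<in> interior ?S" if lt: "\<theta> < b" for \<theta>
  proof -
    obtain s where "s \<in> ?S" "\<theta> < s"
      using lt less_cSup_iff[OF ne bdd, of \<theta>] unfolding b_def by blast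
    then show ?thesis by (intro interior_domainI[of s]) (auto simp: effective_domain_def)
  qed
  \<comment> \<open>Interior points converging to the right end; the shift by 2 keeps them
    positive.\<close>
  define ts where "ts n = b - b / real (n + 2)" for n
  have ts_lt: "ts n < b" for n using b by (simp add: ts_def)
  have ts_pos: "ts n > 0" for n using b by (simp add: ts_def divide_less_eq)
  have ts_lim: "ts \<longlonglongrightarrow> b" unfolding ts_def by real_asymp
  have "b \<in> closure ?S"
    unfolding closure_sequential using ts_lim int[OF ts_lt] interior_subset[of ?S] by blast
  moreover have "b \<notin> interior ?S"
  proof
    assume "b \<in> interior ?S"
    then obtain s where s: "b < s" "\<Lambda> s < \<infinity>" by (rule interior_domain_gt)
    then have "s \<le> b" unfolding b_def by (intro cSup_upper bdd) (simp add: effective_domain_def)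
    with s show False by simp
  qed
  ultimately have "b \<in> frontier ?S" by (simp add: frontier_def)
  moreover have "\<forall>\<theta>s b. (\<forall>n. \<theta>s n \<in> interior ?S) \<and> \<theta>s \<longlonglongrightarrow> b \<and> b \<in> frontier ?S \<longrightarrow>
      filterlim (\<lambda>n. \<bar>deriv F (\<theta>s n)\<bar>) at_top sequentially"
    using source unfolding smoothly_scaling_source_def essentially_smooth_def Let_def by blast
  ultimately have "filterlim (\<lambda>n. \<bar>deriv F (ts n)\<bar>) at_top sequentially"
    using ts_lim int[OF ts_lt] by blast
  then have "\<forall>\<^sub>F n in sequentially. \<bar>deriv F (ts n)\<bar> > y'"
    by (simp add: filterlim_at_top_dense)
  then obtain n where "\<bar>deriv F (ts n)\<bar> > y'" by (auto simp: eventually_sequentially)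
  then have "deriv F (ts n) > y'" using deriv_F_nonneg[OF int[OF ts_lt]] by simp
  then show ?thesis using that ts_pos int[OF ts_lt] by blast
qed

text \<open>Intermediate values of the derivative: minimise \<open>F \<theta> - y' \<theta>\<close>.\<close>

lemma exposing_slope:
  assumes fin: "rate y < \<infinity>" and y: "lam < y'" "y' < y"
  obtains \<eta> where "\<eta> > 0" "\<eta> \<in> interior (effective_domain \<Lambda>)" "(F has_real_derivative y') (at \<eta>)"
proof -
  obtain b where b: "b > 0" "b \<in> interior (effective_domain \<Lambda>)" "deriv F b > y'"
    by (rule steep[OF fin y])
  have int: "\<theta> \<in> interior (effective_domain \<Lambda>)" if "\<theta> \<le> b" for \<theta>
    using interior_domain_le[OF b(2) that] .
  let ?h = "\<lambda>\<theta>. F \<theta> - y' * \<theta>"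
  have der: "(?h has_real_derivative deriv F \<theta> - y') (at \<theta>)" if "\<theta> \<le> b" for \<theta>
    using DERIV_F[OF int[OF that]] by (auto intro!: derivative_eq_intros)
  have "continuous_on {0..b} ?h"
    by (intro DERIV_continuous_on[of _ _ "\<lambda>\<theta>. deriv F \<theta> - y'"] DERIV_subset[OF der]) auto
  then obtain \<eta> where \<eta>: "\<eta> \<in> {0..b}" "\<And>z. z \<in> {0..b} \<Longrightarrow> ?h \<eta> \<le> ?h z"
    using continuous_attains_inf[of "{0..b}" ?h] b by auto
  \<comment> \<open>The slope of \<open>?h\<close> is \<open>lam - y' < 0\<close> at 0 and positive
    at \<open>b\<close>. So neither end is the minimum, which is therefore stationary.\<close>
  have "\<eta> \<noteq> 0"
  proof
    assume "\<eta> = 0"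
    obtain d where d: "d > 0" "\<And>h. h > 0 \<Longrightarrow> h < d \<Longrightarrow> ?h (0 + h) < ?h 0"
      using DERIV_neg_dec_right[OF der[of 0]] b(1) y(1) by (auto simp: deriv_F_zero)
    define h where "h = min (d / 2) b"
    have "h > 0" "h < d" "h \<le> b" using d(1) b(1) by (auto simp: h_def)
    then show False using d(2)[of h] \<eta>(2)[of h] \<open>\<eta> = 0\<close> by simp
  qed
  moreover have "\<eta> \<noteq> b"
  proof
    assume "\<eta> = b"
    obtain d where d: "d > 0" "\<And>h. h > 0 \<Longrightarrow> h < d \<Longrightarrow> ?h (b - h) < ?h b"
      using DERIV_pos_inc_left[OF der[of b]] b(3) by auto
    define h where "h = min (d / 2) b"
    have "h > 0" "h < d" "h \<le> b" using d(1) b(1) by (auto simp: h_def)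
    then show False using d(2)[of h] \<eta>(2)[of "b - h"] \<open>\<eta> = b\<close> by simp
  qed
  ultimately have \<eta>': "0 < \<eta>" "\<eta> < b" using \<eta>(1) by auto
  have "deriv F \<eta> - y' = 0"
  proof (rule DERIV_local_min[OF der])
    show "0 < min \<eta> (b - \<eta>)" using \<eta>' by simp
    show "\<forall>z. \<bar>\<eta> - z\<bar> < min \<eta> (b - \<eta>) \<longrightarrow> ?h \<eta> \<le> ?h z"
      using \<eta>(2) by (auto simp: abs_less_iff)
  qed (use \<eta>' in simp)
  then have "(F has_real_derivative y') (at \<eta>)" using DERIV_F[OF int[of \<eta>]] \<eta>' by simp
  then show ?thesis using that \<eta>'(1) int[of \<eta>] \<eta>'(2) by auto
qed

text \<open>Both ends of the interval serve: the lower one overloads a window, the upper one bounds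
  the number of bits in a slot and with it the loss from picking a bit at random.\<close>

definition gap_prob :: "nat \<Rightarrow> real \<Rightarrow> real \<Rightarrow> real" where
  "gap_prob N x y = measure (M N) {\<omega>\<in>space (M N). A N 1 \<omega> \<in> {k. x * real N < real k \<and> real k < y * real N}}"

text \<open>Tilting by the slope \<open>\<eta>\<close> that exposes the midpoint; the two parts of the tilted expectation
  outside the interval are compared with nearby slopes \<open>\<theta>' < \<eta> < \<theta>\<close>.\<close>

lemma mgf_split:
  assumes N: "N \<ge> 1" and \<eta>: "0 \<le> \<eta>" "\<theta>' \<le> \<eta>" "\<eta> \<le> \<theta>"
  shows "mgf N \<eta> \<le> ennreal (exp (\<eta> * y * G N)) * ennreal (gap_prob N x y) +
    (ennreal (exp (- (\<theta> - \<eta>) * y * G N)) * mgf N \<theta> + ennreal (exp ((\<eta> - \<theta>') * x * G N)) * mgf N \<theta>')"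
proof -
  interpret prob_space "M N" by (rule prob_space_M[OF N])
  have meas [measurable]: "A N t \<in> measurable (M N) (count_space UNIV)" for t
    by (rule measurable_A[OF N])
  have G: "G N > 0" by (rule G_pos[OF N])
  let ?K = "{k. x * real N < real k \<and> real k < y * real N}"
  let ?E = "{\<omega>\<in>space (M N). A N 1 \<omega> \<in> ?K}"
  let ?e = "\<lambda>\<theta> \<omega>. ennreal (exp (\<theta> * G N / real N * real (A N 1 \<omega>)))"
  have "mgf N \<eta> \<le> (\<integral>\<^sup>+ \<omega>. ennreal (exp (\<eta> * y * G N)) * indicator ?E \<omega> +
      (ennreal (exp (- (\<theta> - \<eta>) * y * G N)) * ?e \<theta> \<omega> + ennreal (exp ((\<eta> - \<theta>') * x * G N)) * ?e \<theta>' \<omega>) \<partial>M N)"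
    unfolding mgf_def
  proof (rule nn_integral_mono)
    fix \<omega> assume \<omega>: "\<omega> \<in> space (M N)"
    define X where "X = real (A N 1 \<omega>) / real N"
    have X: "u * G N / real N * real (A N 1 \<omega>) = u * X * G N" for u by (simp add: X_def)
    have less: "x < X \<longleftrightarrow> x * real N < real (A N 1 \<omega>)" "X < y \<longleftrightarrow> real (A N 1 \<omega>) < y * real N"
      using N by (simp_all add: X_def pos_less_divide_eq pos_divide_less_eq)
    \<comment> \<open>Inside the interval the tilt is bounded by its value at \<open>y\<close>. From
      \<open>y\<close> on it is dominated by the larger slope \<open>\<theta>\<close>, up to
      \<open>x\<close> by the smaller slope \<open>\<theta>'\<close>, each normalized at the
      endpoint.\<close>
    consider "x < X \<and> X < y" | "X \<ge> y" | "X \<le> x" by linarith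
    then show "?e \<eta> \<omega> \<le> ennreal (exp (\<eta> * y * G N)) * indicator ?E \<omega> +
      (ennreal (exp (- (\<theta> - \<eta>) * y * G N)) * ?e \<theta> \<omega> + ennreal (exp ((\<eta> - \<theta>') * x * G N)) * ?e \<theta>' \<omega>)"
    proof cases
      case 1
      then have "\<omega> \<in> ?E" using \<omega> less by simp
      moreover have "\<eta> * X * G N \<le> \<eta> * y * G N"
        using 1 G \<eta> by (intro mult_right_mono mult_left_mono) auto
      ultimately have "?e \<eta> \<omega> \<le> ennreal (exp (\<eta> * y * G N)) * indicator ?E \<omega>"
        unfolding X by (simp add: ennreal_leI)
      then show ?thesis by (rule order_trans) simp
    next
      case 2
      have "(\<theta> - \<eta>) * y * G N \<le> (\<theta> - \<eta>) * X * G N"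
        using 2 G \<eta> by (intro mult_right_mono mult_left_mono) auto
      then have "\<eta> * X * G N \<le> - (\<theta> - \<eta>) * y * G N + \<theta> * X * G N" by (simp add: algebra_simps)
      then have "?e \<eta> \<omega> \<le> ennreal (exp (- (\<theta> - \<eta>) * y * G N)) * ?e \<theta> \<omega>"
        unfolding X by (simp add: ennreal_mult[symmetric] exp_add[symmetric] ennreal_leI)
      then show ?thesis by (rule order_trans) (simp add: add_increasing add_increasing2)
    next
      case 3
      have "(\<eta> - \<theta>') * X * G N \<le> (\<eta> - \<theta>') * x * G N"
        using 3 G \<eta> by (intro mult_right_mono mult_left_mono) auto
      then have "\<eta> * X * G N \<le> (\<eta> - \<theta>') * x * G N + \<theta>' * X * G N" by (simp add: algebra_simps)
      then have "?e \<eta> \<omega> \<le> ennreal (exp ((\<eta> - \<theta>') * x * G N)) * ?e \<theta>' \<omega>"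
        unfolding X by (simp add: ennreal_mult[symmetric] exp_add[symmetric] ennreal_leI)
      then show ?thesis by (rule order_trans) (simp add: add_increasing add_increasing2)
    qed
  qed
  also have "\<dots> = ennreal (exp (\<eta> * y * G N)) * (\<integral>\<^sup>+ \<omega>. indicator ?E \<omega> \<partial>M N) +
    (ennreal (exp (- (\<theta> - \<eta>) * y * G N)) * mgf N \<theta> + ennreal (exp ((\<eta> - \<theta>') * x * G N)) * mgf N \<theta>')"
    unfolding mgf_def by (simp add: nn_integral_add nn_integral_cmult)
  finally show ?thesis by (simp add: gap_prob_def emeasure_eq_measure)
qed

text \<open>The slope of \<open>F\<close> at \<open>\<eta>\<close> lies strictly between
  \<open>x\<close> and \<open>y\<close>, so for nearby \<open>\<theta>\<close> and
  \<open>\<theta>'\<close> both side terms of \<open>mgf_split\<close> are exponentially smaller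
  than \<open>mgf N \<eta>\<close>. The interval must carry the rest, at the price
  \<open>\<eta> * y - F \<eta> \<le> rate y\<close>.\<close>

lemma gap_prob_lower_bound:
  assumes x: "lam < x" "x < y" and l: "rate y < ereal l"
  shows "\<forall>\<^sub>F N in sequentially. exp (- l * G N) \<le> gap_prob N x y"
proof -
  define y' where "y' = (x + y) / 2"
  have y': "x < y'" "y' < y" using x by (auto simp: y'_def)
  have fin: "rate y < \<infinity>" using l by auto
  obtain \<eta> where \<eta>: "\<eta> > 0" "\<eta> \<in> interior (effective_domain \<Lambda>)" "(F has_real_derivative y') (at \<eta>)"
    using exposing_slope[OF fin, of y'] x y' by (metis less_trans)
  obtain b where b: "\<eta> < b" "\<Lambda> b < \<infinity>" by (rule interior_domain_gt[OF \<eta>(2)])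
  have finb: "\<Lambda> \<theta> < \<infinity>" if "\<theta> \<le> b" for \<theta> using finite_below[OF that b(2)] .
  have "((\<lambda>\<theta>. F \<theta> - y * \<theta>) has_real_derivative (y' - y)) (at \<eta>)"
    by (auto intro!: derivative_eq_intros \<eta>)
  from DERIV_neg_dec_right[OF this] y' obtain d1 where
    d1: "d1 > 0" "\<And>h. h > 0 \<Longrightarrow> h < d1 \<Longrightarrow> F (\<eta> + h) - y * (\<eta> + h) < F \<eta> - y * \<eta>" by auto
  have "((\<lambda>\<theta>. F \<theta> - x * \<theta>) has_real_derivative (y' - x)) (at \<eta>)"
    by (auto intro!: derivative_eq_intros \<eta>)
  from DERIV_pos_inc_left[OF this] y' obtain d2 where
    d2: "d2 > 0" "\<And>h. h > 0 \<Longrightarrow> h < d2 \<Longrightarrow> F (\<eta> - h) - x * (\<eta> - h) < F \<eta> - x * \<eta>" by auto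
  \<comment> \<open>The cap at \<open>b\<close> keeps \<open>\<theta>\<close> in the effective
    domain.\<close>
  define \<theta> where "\<theta> = \<eta> + min (d1 / 2) (b - \<eta>)"
  define \<theta>' where "\<theta>' = \<eta> - d2 / 2"
  have \<theta>: "\<eta> < \<theta>" "\<theta> \<le> b" "F \<theta> - y * \<theta> < F \<eta> - y * \<eta>"
    using d1(1) b(1) d1(2)[of "min (d1 / 2) (b - \<eta>)"] by (auto simp: \<theta>_def)
  have \<theta>': "\<theta>' < \<eta>" "\<theta>' \<le> b" "F \<theta>' - x * \<theta>' < F \<eta> - x * \<eta>"
    using d2(1) b(1) d2(2)[of "d2 / 2"] by (auto simp: \<theta>'_def)
  have "ereal (\<eta> * y) - ereal (F \<eta>) \<le> rate y"
    using rate_ge[of \<eta> y] \<Lambda>_eq_F[OF finb[of \<eta>]] b by simp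
  then have l': "\<eta> * y - F \<eta> < l" using l by (auto dest: le_less_trans)
  \<comment> \<open>A third of the smallest margin: \<open>e\<close> covers the error in each
    \<open>mgf\<close>, and the side terms still stay a factor \<open>exp (- e * G N)\<close> below
    the main one, so that both together take at most half of it.\<close>
  define e where "e = min (l - (\<eta> * y - F \<eta>))
    (min ((F \<eta> - y * \<eta>) - (F \<theta> - y * \<theta>)) ((F \<eta> - x * \<eta>) - (F \<theta>' - x * \<theta>'))) / 3"
  have e: "e > 0" "3 * e \<le> l - (\<eta> * y - F \<eta>)"
    "3 * e \<le> (F \<eta> - y * \<eta>) - (F \<theta> - y * \<theta>)" "3 * e \<le> (F \<eta> - x * \<eta>) - (F \<theta>' - x * \<theta>')"
    using l' \<theta>(3) \<theta>'(3) by (auto simp: e_def)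
  have ev: "\<forall>\<^sub>F N in sequentially. mgf N t < ennreal (exp ((F t + e) * G N))" if "t \<le> b" for t
    by (rule mgf_less) (metis \<Lambda>_eq_F[OF finb[OF that]] e(1) less_add_same_cancel1 less_ereal.simps(1))
  have ev': "\<forall>\<^sub>F N in sequentially. ennreal (exp ((F \<eta> - e) * G N)) < mgf N \<eta>"
    by (rule mgf_greater) (metis \<Lambda>_eq_F[OF finb[OF less_imp_le[OF b(1)]]] e(1) diff_less_eq less_add_same_cancel1 less_ereal.simps(1))
  show ?thesis
    using ev[OF \<theta>(2)] ev[OF \<theta>'(2)] ev' const_le_exp_G[OF e(1), of 4] eventually_ge_1
  proof eventually_elim
    case (elim N)
    have G: "G N > 0" by (rule G_pos[OF elim(5)])
    let ?P = "gap_prob N x y"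
    have P: "?P \<ge> 0" by (simp add: gap_prob_def)
    have "ennreal (exp ((F \<eta> - e) * G N)) \<le> mgf N \<eta>" using elim(3) by simp
    also have "\<dots> \<le> ennreal (exp (\<eta> * y * G N)) * ennreal ?P +
      (ennreal (exp (- (\<theta> - \<eta>) * y * G N)) * mgf N \<theta> + ennreal (exp ((\<eta> - \<theta>') * x * G N)) * mgf N \<theta>')"
      using \<eta> \<theta> \<theta>' by (intro mgf_split[OF elim(5)]) auto
    also have "\<dots> \<le> ennreal (exp (\<eta> * y * G N)) * ennreal ?P +
      (ennreal (exp (- (\<theta> - \<eta>) * y * G N)) * ennreal (exp ((F \<theta> + e) * G N)) +
       ennreal (exp ((\<eta> - \<theta>') * x * G N)) * ennreal (exp ((F \<theta>' + e) * G N)))"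
      using elim(1,2) by (intro add_mono order_refl mult_left_mono less_imp_le) auto
    also have "\<dots> = ennreal (exp (\<eta> * y * G N) * ?P +
      (exp ((F \<theta> + e - (\<theta> - \<eta>) * y) * G N) + exp ((F \<theta>' + e + (\<eta> - \<theta>') * x) * G N)))"
      using P by (simp add: ennreal_mult[symmetric] ennreal_plus[symmetric] exp_add[symmetric] algebra_simps
          del: ennreal_plus)
    finally have "exp ((F \<eta> - e) * G N) \<le> exp (\<eta> * y * G N) * ?P +
      (exp ((F \<theta> + e - (\<theta> - \<eta>) * y) * G N) + exp ((F \<theta>' + e + (\<eta> - \<theta>') * x) * G N))"
      using P by (subst (asm) ennreal_le_iff) auto
    moreover have "exp ((F \<theta> + e - (\<theta> - \<eta>) * y) * G N) \<le> exp ((F \<eta> - 2 * e) * G N)"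
    proof -
      have "F \<theta> + e - (\<theta> - \<eta>) * y \<le> F \<eta> - 2 * e" using e(3) by (simp add: algebra_simps)
      then show ?thesis using G by (simp add: mult_right_mono)
    qed
    moreover have "exp ((F \<theta>' + e + (\<eta> - \<theta>') * x) * G N) \<le> exp ((F \<eta> - 2 * e) * G N)"
    proof -
      have "F \<theta>' + e + (\<eta> - \<theta>') * x \<le> F \<eta> - 2 * e" using e(4) by (simp add: algebra_simps)
      then show ?thesis using G by (simp add: mult_right_mono)
    qed
    moreover have "4 * exp ((F \<eta> - 2 * e) * G N) \<le> exp (e * G N) * exp ((F \<eta> - 2 * e) * G N)"
      using elim(4) by (intro mult_right_mono) auto
    moreover have "exp (e * G N) * exp ((F \<eta> - 2 * e) * G N) = exp ((F \<eta> - e) * G N)"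
      by (simp add: exp_add[symmetric] algebra_simps)
    ultimately have "2 * exp ((F \<eta> - 2 * e) * G N) \<le> exp (\<eta> * y * G N) * ?P" by linarith
    then have "exp ((F \<eta> - 2 * e) * G N) \<le> exp (\<eta> * y * G N) * ?P"
      using exp_gt_zero[of "(F \<eta> - 2 * e) * G N"] by linarith
    then have "exp (- (\<eta> * y * G N)) * exp ((F \<eta> - 2 * e) * G N) \<le> exp (- (\<eta> * y * G N)) * (exp (\<eta> * y * G N) * ?P)"
      by (intro mult_left_mono) auto
    also have "\<dots> = ?P" by (simp add: exp_minus field_simps)
    finally have "exp ((F \<eta> - 2 * e - \<eta> * y) * G N) \<le> ?P"
      by (simp add: exp_add[symmetric] algebra_simps)
    moreover have "- l * G N \<le> (F \<eta> - 2 * e - \<eta> * y) * G N"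
      using e(1,2) G by (intro mult_right_mono) auto
    ultimately show ?case by (meson exp_le_cancel_iff order_trans)
  qed
qed

end

section \<open>The delay violation probability\<close>

lemma measurable_queue_from [measurable]:
  assumes [measurable]: "\<And>t. (a t) \<in> measurable M (count_space UNIV)"
  shows "(\<lambda>\<omega>. queue_from B T (\<lambda>t. a t \<omega>) s n) \<in> borel_measurable M"
  by (induction n) (auto simp: Let_def intro!: borel_measurable_max borel_measurable_diff borel_measurable_add)

lemma measurable_bit_position:
  assumes [measurable]: "\<And>t. (a t) \<in> measurable M (count_space UNIV)"
  shows "(\<lambda>\<omega>. bit_position B T (\<lambda>t. a t \<omega>) i j) \<in> borel_measurable M"
  unfolding bit_position_def queue_def by measurable

lemma I_fun_windows:
  "I_fun D \<Lambda> r T = (INF n\<in>windows D T.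
     ereal (real n) * convex_conjugate \<Lambda> (r + (real D + 1 - 2 * real T) * r / real n))"
  by (simp add: I_fun_def windows_def)

text \<open>If \<open>Q\<close> has probability 0, \<open>cond_prob\<close> is 0 by division by
  zero, and both sides vanish.\<close>

lemma cond_prob_mult:
  assumes "prob_space M" and [measurable]: "Measurable.pred M Q"
  shows "measure M {\<omega>\<in>space M. Q \<omega>} * cond_prob M P Q = measure M {\<omega>\<in>space M. P \<omega> \<and> Q \<omega>}"
proof (cases "measure M {\<omega>\<in>space M. Q \<omega>} = 0")
  case True
  interpret prob_space M by fact
  have "measure M {\<omega>\<in>space M. P \<omega> \<and> Q \<omega>} \<le> measure M {\<omega>\<in>space M. Q \<omega>}"
    by (rule finite_measure_mono) auto
  with True have "measure M {\<omega>\<in>space M. P \<omega> \<and> Q \<omega>} = 0"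
    using measure_nonneg[of M "{\<omega>\<in>space M. P \<omega> \<and> Q \<omega>}"] by simp
  then show ?thesis using True by (simp add: cond_prob_def)
qed (simp add: cond_prob_def)

section \<open>A randomly chosen bit in a single system\<close>

locale delay_setting =
  fixes M :: "'a measure" and A :: "int \<Rightarrow> 'a \<Rightarrow> nat" and b :: real and T D :: nat
  assumes prob_M: "prob_space M"
    and measurable_arrivals [measurable]: "\<And>t. A t \<in> measurable M (count_space UNIV)"
    and b_pos: "0 < b" and T_pos: "1 \<le> T" and T_le: "2 * T \<le> D"
begin

sublocale prob_space M by (rule prob_M)

abbreviation "slack \<equiv> real D + 1 - 2 * real T"

abbreviation "viol \<equiv> delay_violation_at M A (b * real T) T D"

definition late :: "nat \<Rightarrow> nat \<Rightarrow> 'a \<Rightarrow> bool" where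
  "late i j \<omega> \<longleftrightarrow> bit_delay (b * real T) T i (bit_position (b * real T) T (\<lambda>t. A t \<omega>) i j) > ereal (real D)"

definition overload :: "nat \<Rightarrow> nat \<Rightarrow> 'a set" where
  "overload i n = {\<omega>\<in>space M. b * (real n + slack) < (\<Sum>t\<in>{int i - int n<..int i}. real (A t \<omega>))}"

lemma sets_overload [measurable]: "overload i n \<in> sets M"
  unfolding overload_def by measurable

lemma pred_late: 
  assumes "i < T"
  shows "Measurable.pred M (late i j)"
proof -
  have "late i j = (\<lambda>\<omega>. bit_position (b * real T) T (\<lambda>t. A t \<omega>) i j >
      ereal (real ((D - T + i) div T) * (b * real T)))"
    unfolding late_def using bit_delay_gt_iff[of "b * real T" i T D] b_pos T_pos T_le assms
    by (simp add: bit_position_not_MInf)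
  then show ?thesis using measurable_bit_position[OF measurable_arrivals] by simp
qed

definition violation_term :: "nat \<Rightarrow> nat \<Rightarrow> real" where
  "violation_term i a = (1 / real a) * (\<Sum>j=1..a. prob {\<omega>\<in>space M. late i j \<omega> \<and> A (int i) \<omega> = a})"

lemma viol_eq: "viol i = (\<Sum>\<^sub>\<infinity>a\<in>{1..}. violation_term i a)"
  unfolding delay_violation_at_def violation_term_def late_def[symmetric]
proof (rule infsum_cong)
  fix a
  let ?q = "prob {\<omega>\<in>space M. A (int i) \<omega> = a}"
  have "?q * cond_prob M (late i j) (\<lambda>\<omega>. A (int i) \<omega> = a) = prob {\<omega>\<in>space M. late i j \<omega> \<and> A (int i) \<omega> = a}" for j
    by (rule cond_prob_mult[OF prob_M]) measurable
  then show "?q * (1 / real a) * (\<Sum>j=1..a. cond_prob M (late i j) (\<lambda>\<omega>. A (int i) \<omega> = a)) =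
      1 / real a * (\<Sum>j=1..a. prob {\<omega>\<in>space M. late i j \<omega> \<and> A (int i) \<omega> = a})"
    by (simp add: sum_distrib_left mult.assoc mult.left_commute[of ?q])
qed

lemma violation_term_nonneg: "violation_term i a \<ge> 0"
  by (simp add: violation_term_def sum_nonneg)

lemma late_imp_overload:
  assumes "i < T" "\<omega> \<in> space M" "late i j \<omega>" "j \<le> A (int i) \<omega>"
  shows "\<omega> \<in> (\<Union>n\<in>windows D T. overload i n)"
  using delay_imp_window[OF T_pos T_le assms(1) b_pos, of j "\<lambda>t. A t \<omega>"] assms
  by (auto simp: late_def overload_def)

text \<open>Averaging over the \<open>a\<close> bits cancels the factor \<open>1 / a\<close>, since
  lateness of any of them implies the same overload event.\<close>

lemma violation_term_le:
  assumes i: "i < T"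
  shows "violation_term i a \<le> prob ({\<omega>\<in>space M. A (int i) \<omega> = a} \<inter> (\<Union>n\<in>windows D T. overload i n))"
    (is "_ \<le> ?p")
proof -
  have "prob {\<omega>\<in>space M. late i j \<omega> \<and> A (int i) \<omega> = a} \<le> ?p" if "j \<in> {1..a}" for j
    using late_imp_overload[OF i, of _ j] that by (intro finite_measure_mono) auto
  then have "(\<Sum>j=1..a. prob {\<omega>\<in>space M. late i j \<omega> \<and> A (int i) \<omega> = a}) \<le> (\<Sum>j=1..a. ?p)"
    by (intro sum_mono)
  then show ?thesis by (cases "a = 0") (simp_all add: violation_term_def field_simps)
qed

lemma sum_violation_term_le:
  assumes i: "i < T" and S: "finite S"
  shows "sum (violation_term i) S \<le> prob (\<Union>n\<in>windows D T. overload i n)"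
proof -
  let ?U = "\<Union>n\<in>windows D T. overload i n"
  let ?V = "\<lambda>a. {\<omega>\<in>space M. A (int i) \<omega> = a} \<inter> ?U"
  have "sum (violation_term i) S \<le> (\<Sum>a\<in>S. prob (?V a))"
    by (intro sum_mono violation_term_le i)
  also have "\<dots> = prob (\<Union>a\<in>S. ?V a)"
    using S by (intro finite_measure_finite_Union[symmetric]) (auto simp: disjoint_family_on_def)
  also have "\<dots> \<le> prob ?U" by (intro finite_measure_mono) auto
  finally show ?thesis .
qed

text \<open>An \<open>infsum\<close> without summability is 0 by default, which would spoil lower
  bounds on \<open>viol\<close>. Finite sums are bounded because the events for different
  \<open>a\<close> are disjoint.\<close>

lemma summable_violation_term: "i < T \<Longrightarrow> violation_term i summable_on {1..}"
  by (intro nonneg_bdd_above_summable_on bdd_aboveI2[OF sum_violation_term_le] violation_term_nonneg) auto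

lemma viol_nonneg: "viol i \<ge> 0"
  unfolding viol_eq by (intro infsum_nonneg violation_term_nonneg)

lemma viol_le:
  assumes "i < T"
  shows "viol i \<le> prob (\<Union>n\<in>windows D T. overload i n)"
  unfolding viol_eq
  by (rule infsum_le_finite_sums[OF summable_violation_term[OF assms] sum_violation_term_le[OF assms]])

text \<open>A bit picked at random among \<open>a \<le> c\<close> bits is the last one with
  probability at least \<open>1 / c\<close>, so lateness of the last bit on \<open>V\<close>
  suffices.\<close>

lemma viol_ge:
  assumes i: "i < T" and V: "V \<in> sets M" and c: "c > 0"
    and V_sub: "\<And>\<omega>. \<omega> \<in> V \<Longrightarrow> 1 \<le> A (int i) \<omega> \<and> real (A (int i) \<omega>) \<le> c \<and> late i (A (int i) \<omega>) \<omega>"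
  shows "prob V / c \<le> viol i"
proof -
  define S where "S = {a. 1 \<le> a \<and> real a \<le> c}"
  have "S \<subseteq> {..nat \<lceil>c\<rceil>}"
  proof
    fix a assume "a \<in> S"
    then have "real a \<le> real (nat \<lceil>c\<rceil>)"
      unfolding S_def using real_nat_ceiling_ge[of c] by (blast intro: order_trans)
    then show "a \<in> {..nat \<lceil>c\<rceil>}" by simp
  qed
  then have S: "finite S" "S \<subseteq> {1..}" by (auto simp: S_def intro: finite_subset)
  let ?V = "\<lambda>a. {\<omega>\<in>space M. A (int i) \<omega> = a} \<inter> V"
  have "V = (\<Union>a\<in>S. ?V a)" using V_sub sets.sets_into_space[OF V] by (auto simp: S_def)
  then have "prob V = prob (\<Union>a\<in>S. ?V a)" by simp
  also have "\<dots> = (\<Sum>a\<in>S. prob (?V a))"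
    using S V by (intro finite_measure_finite_Union) (auto simp: disjoint_family_on_def)
  finally have "prob V / c = (\<Sum>a\<in>S. prob (?V a) / c)" by (simp add: sum_divide_distrib)
  also have "\<dots> \<le> (\<Sum>a\<in>S. violation_term i a)"
  proof (rule sum_mono)
    fix a assume a: "a \<in> S"
    have [measurable]: "Measurable.pred M (late i a)" by (rule pred_late[OF i])
    have "prob (?V a) \<le> prob {\<omega>\<in>space M. late i a \<omega> \<and> A (int i) \<omega> = a}"
      using V_sub by (intro finite_measure_mono) auto
    also have "\<dots> \<le> (\<Sum>j=1..a. prob {\<omega>\<in>space M. late i j \<omega> \<and> A (int i) \<omega> = a})"
      using a by (intro member_le_sum[of a]) (auto simp: S_def)
    finally have "prob (?V a) / real a \<le> violation_term i a"
      by (simp add: violation_term_def divide_right_mono)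
    moreover have "prob (?V a) / c \<le> prob (?V a) / real a"
      using a c by (intro divide_left_mono) (auto simp: S_def)
    ultimately show "prob (?V a) / c \<le> violation_term i a" by simp
  qed
  also have "\<dots> \<le> viol i"
    unfolding viol_eq using S
    by (intro finite_sum_le_infsum summable_violation_term i violation_term_nonneg) auto
  finally show ?thesis .
qed

text \<open>Union bound split at \<open>n0\<close>: the short windows cost at most \<open>n0\<close>
  times their common bound, the long ones a geometric series whose factor \<open>1 / (1 - q)\<close>
  is at most 2.\<close>

lemma prob_overload_Union_le:
  assumes q: "0 < q" "q \<le> 1 / 2" and p: "0 \<le> p"
    and tail: "\<And>n. n \<ge> n0 \<Longrightarrow> prob (overload i n) \<le> q ^ n"
    and head: "\<And>n. n \<in> windows D T \<Longrightarrow> n < n0 \<Longrightarrow> prob (overload i n) \<le> p"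
  shows "prob (\<Union>n\<in>windows D T. overload i n) \<le> real n0 * p + 2 * q ^ n0"
proof -
  let ?H = "\<Union>n\<in>windows D T \<inter> {..<n0}. overload i n" and ?T = "\<Union>k. overload i (n0 + k)"
  have geo: "summable (\<lambda>k. q ^ (n0 + k))" "(\<Sum>k. q ^ (n0 + k)) = q ^ n0 / (1 - q)"
    using q by (auto simp: power_add suminf_mult suminf_geometric summable_geometric intro!: summable_mult)
  have sum: "summable (\<lambda>k. prob (overload i (n0 + k)))"
    by (rule summable_comparison_test'[OF geo(1)]) (simp add: tail)
  have "prob (\<Union>n\<in>windows D T. overload i n) \<le> prob (?H \<union> ?T)"
  proof (rule finite_measure_mono)
    show "(\<Union>n\<in>windows D T. overload i n) \<subseteq> ?H \<union> ?T"
    proof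
      fix \<omega> assume "\<omega> \<in> (\<Union>n\<in>windows D T. overload i n)"
      then obtain n where n: "n \<in> windows D T" "\<omega> \<in> overload i n" by blast
      show "\<omega> \<in> ?H \<union> ?T"
      proof (cases "n < n0")
        case False
        then have "n = n0 + (n - n0)" by simp
        with n show ?thesis by (metis UNIV_I UN_iff UnCI)
      qed (use n in auto)
    qed
  qed measurable
  also have "\<dots> \<le> prob ?H + prob ?T" by (rule measure_Un_le) measurable
  also have "prob ?H \<le> (\<Sum>n\<in>windows D T \<inter> {..<n0}. prob (overload i n))"
    by (rule finite_measure_subadditive_finite) auto
  also have "\<dots> \<le> (\<Sum>n\<in>windows D T \<inter> {..<n0}. p)" by (rule sum_mono) (simp add: head)
  also have "\<dots> \<le> real n0 * p"
    using p card_mono[of "{..<n0}" "windows D T \<inter> {..<n0}"] by (simp add: mult_right_mono)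
  also have "prob ?T \<le> (\<Sum>k. prob (overload i (n0 + k)))"
    by (rule finite_measure_subadditive_countably[OF _ sum]) auto
  also have "\<dots> \<le> (\<Sum>k. q ^ (n0 + k))" by (rule suminf_le[OF _ sum geo(1)]) (simp add: tail)
  also have "\<dots> = q ^ n0 / (1 - q)" by (rule geo(2))
  also have "\<dots> \<le> q ^ n0 / (1 / 2)" using q by (intro divide_left_mono) auto
  finally show ?thesis by simp
qed

end

lemma threshold_eq: "n \<ge> 1 \<Longrightarrow> real n * (r + s * r / real n) = r * (real n + s)"
  by (simp add: field_simps)

context smooth_source
begin

text \<open>A single slope with positive margin at \<open>r\<close> serves all larger
  \<open>x\<close>, so the bound survives the infimum over infinitely many windows.\<close>

lemma rate_pos:
  assumes "lam < r"
  obtains \<delta> where "\<delta> > 0" "\<And>x. r \<le> x \<Longrightarrow> ereal \<delta> \<le> rate x"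
proof -
  obtain \<theta> \<delta> where \<theta>: "\<theta> > 0" "\<delta> > 0" "\<Lambda> \<theta> < ereal (\<theta> * r - \<delta>)"
    by (rule exponent_above_mean[OF assms])
  obtain f where f: "\<Lambda> \<theta> = ereal f" using \<theta>(3) \<Lambda>_not_MInf[of \<theta>] by (cases "\<Lambda> \<theta>") auto
  have "ereal \<delta> \<le> rate x" if "r \<le> x" for x
  proof -
    have "\<theta> * r \<le> \<theta> * x" using \<theta>(1) that by simp
    then have "ereal \<delta> \<le> ereal (\<theta> * x) - \<Lambda> \<theta>" using \<theta>(3) unfolding f by simp
    also have "\<dots> \<le> rate x" by (rule rate_ge)
    finally show ?thesis .
  qed
  with \<theta>(2) show ?thesis by (rule that)
qed

section \<open>Decay of the delay violation probability for fixed \<open>T\<close>\<close>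

context
  fixes D T :: nat
  assumes T_pos: "1 \<le> T" and T_le: "2 * T \<le> D"
begin

abbreviation "slack \<equiv> real D + 1 - 2 * real T"

abbreviation "I r \<equiv> I_fun D \<Lambda> r T"

text \<open>For \<open>r > 0\<close> this puts the per-slot threshold of every window strictly above
  \<open>r\<close>.\<close>

lemma slack_pos: "slack \<ge> 1"
  using T_le by linarith

lemma window_pos: "n \<in> windows D T \<Longrightarrow> n \<ge> 1"
  by (auto simp: windows_def)

lemma I_pos:
  assumes "lam < r"
  shows "0 < I r"
proof -
  obtain \<delta> where \<delta>: "\<delta> > 0" "\<And>x. r \<le> x \<Longrightarrow> ereal \<delta> \<le> rate x" by (rule rate_pos[OF assms]) blast
  have "ereal \<delta> \<le> I r"
    unfolding I_fun_windows
  proof (rule INF_greatest)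
    fix n assume "n \<in> windows D T"
    then have n: "n \<ge> 1" by (rule window_pos)
    have "r \<le> r + slack * r / real n" using slack_pos assms lam_pos by simp
    then have "ereal \<delta> \<le> rate (r + slack * r / real n)" by (rule \<delta>(2))
    also have "\<dots> = 1 * rate (r + slack * r / real n)" by simp
    also have "\<dots> \<le> ereal (real n) * rate (r + slack * r / real n)"
      using n by (intro ereal_mult_right_mono rate_nonneg) (simp add: one_ereal_def)
    finally show "ereal \<delta> \<le> ereal (real n) * rate (r + slack * r / real n)" .
  qed
  moreover have "0 < ereal \<delta>" using \<delta>(1) by simp
  ultimately show ?thesis by (rule less_le_trans[rotated])
qed

text \<open>Since \<open>lam > 0\<close>, convexity of the rate through its zero \<open>lam\<close> bounds its growth along rays.\<close>

lemma I_scaled: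
  assumes r: "lam < r1" "r1 \<le> r2"
  shows "ereal (r2 / r1) * I r1 \<le> I r2"
  unfolding I_fun_windows[of D \<Lambda> r2]
proof (rule INF_greatest)
  fix n assume nw: "n \<in> windows D T"
  then have n: "n \<ge> 1" by (rule window_pos)
  \<comment> \<open>The per-slot threshold is \<open>r\<close> times a factor
    \<open>u \<ge> 1\<close> independent of \<open>r\<close>, so passing from \<open>r1\<close> to
    \<open>r2\<close> moves along a ray.\<close>
  define u where "u = 1 + slack / real n"
  have u: "u \<ge> 1" using slack_pos by (simp add: u_def)
  have r1: "r1 > 0" using r lam_pos by simp
  have ru: "r + slack * r / real n = r * u" for r by (simp add: u_def distrib_left mult.commute)
  have "r1 * 1 \<le> r1 * u" using u r1 by (intro mult_left_mono) auto
  then have lt: "lam < r1 * u" using r by linarith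
  have le: "r1 * u \<le> r2 * u" using r u by (intro mult_right_mono) auto
  \<comment> \<open>Subtracting \<open>lam\<close> reduces the smaller of two numbers by the larger
    proportion.\<close>
  have frac: "(r1 * u - lam) / (r2 * u - lam) \<le> r1 / r2"
  proof -
    have "r1 * lam \<le> r2 * lam" using r lam_pos by (intro mult_right_mono) auto
    then have "(r1 * u - lam) * r2 \<le> r1 * (r2 * u - lam)" by (simp add: algebra_simps)
    then show ?thesis using lt le r r1 by (simp add: field_simps)
  qed
  have "rate (r1 * u) \<le> ereal ((r1 * u - lam) / (r2 * u - lam)) * rate (r2 * u)"
    by (rule rate_le_scaled[OF lt le])
  also have "\<dots> \<le> ereal (r1 / r2) * rate (r2 * u)"
    using frac by (intro ereal_mult_right_mono rate_nonneg) simp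
  finally have *: "rate (r1 * u) \<le> ereal (r1 / r2) * rate (r2 * u)" .
  have "I r1 \<le> ereal (real n) * rate (r1 * u)"
    unfolding I_fun_windows ru[symmetric] by (rule INF_lower[OF nw])
  also have "\<dots> \<le> ereal (real n) * (ereal (r1 / r2) * rate (r2 * u))"
    by (rule ereal_mult_left_mono[OF *]) simp
  finally have "ereal (r2 / r1) * I r1 \<le> ereal (r2 / r1) * (ereal (real n) * (ereal (r1 / r2) * rate (r2 * u)))"
    using r r1 by (intro ereal_mult_left_mono) auto
  also have "\<dots> = ereal (r2 / r1 * real n * (r1 / r2)) * rate (r2 * u)"
    by (simp add: mult.assoc[symmetric])
  also have "r2 / r1 * real n * (r1 / r2) = real n" using r r1 by simp
  finally show "ereal (r2 / r1) * I r1 \<le> ereal (real n) * rate (r2 + slack * r2 / real n)"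
    unfolding ru .
qed

lemma delay_setting:
  assumes "N \<ge> 1" "lam < r"
  shows "delay_setting (M N) (A N) (r * real N) T D"
proof (rule delay_setting.intro)
  show "0 < r * real N" using assms lam_pos by simp
qed (fact prob_space_M[OF assms(1)] measurable_A[OF assms(1)] T_pos T_le)+

lemma delay_prob_nonneg:
  assumes "N \<ge> 1" "lam < r"
  shows "delay_prob M A D r T N \<ge> 0"
  unfolding delay_prob_def using delay_setting.viol_nonneg[OF delay_setting[OF assms]]
  by (intro divide_nonneg_nonneg sum_nonneg) auto

text \<open>The Chernoff slope, and the \<open>N\<close> from which its bound holds, depend on the
  window, so only finitely many windows can have their own. All others share the slope
  \<open>\<theta>0\<close>, with exponent at least \<open>n * \<delta>\<close>.\<close>

lemma delay_prob_upper_bound: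
  assumes r: "lam < r" and l: "ereal l < I r"
  shows "decays_at_least (delay_prob M A D r T) G l"
proof -
  \<comment> \<open>Room above \<open>l\<close> will absorb the factor \<open>n0 + 2\<close>;
    positivity of \<open>l1\<close> is what the choice of nonnegative slopes asks for.\<close>
  have "max (ereal l) 0 < I r" using l I_pos[OF r] by simp
  then obtain l1 where l1: "max (ereal l) 0 < ereal l1" "ereal l1 < I r" using ereal_dense2 by blast
  then have l1': "l < l1" "0 < l1" by auto
  obtain \<theta>0 \<delta> where \<theta>0: "\<theta>0 > 0" "\<delta> > 0" "\<Lambda> \<theta>0 < ereal (\<theta>0 * r - \<delta>)"
    by (rule exponent_above_mean[OF r])
  \<comment> \<open>From \<open>n0\<close> on, the shared exponent \<open>n * \<delta>\<close>
    already reaches \<open>l1\<close>.\<close>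
  obtain n0 :: nat where n0: "l1 \<le> real n0 * \<delta>"
    using reals_Archimedean3[OF \<theta>0(2)] by (meson less_imp_le)
  let ?E = "\<lambda>N i n. {\<omega>\<in>space (M N). real N * (r * (real n + slack)) < (\<Sum>t\<in>{int i - int n<..int i}. real (A N t \<omega>))}"
  have head: "\<forall>\<^sub>F N in sequentially. \<forall>i. measure (M N) (?E N i n) \<le> exp (- l1 * G N)"
    if nw: "n \<in> windows D T" for n
  proof -
    have n: "n \<ge> 1" by (rule window_pos[OF nw])
    define x where "x = r + slack * r / real n"
    have nx: "real n * x = r * (real n + slack)" unfolding x_def by (rule threshold_eq[OF n])
    have "r \<le> x" using slack_pos r lam_pos by (simp add: x_def)
    then have x: "lam < x" using r by simp
    have "ereal l1 < ereal (real n) * rate x"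
      using l1(2) INF_lower[OF nw, of "\<lambda>n. ereal (real n) * rate (r + slack * r / real n)"]
      unfolding I_fun_windows x_def by (rule less_le_trans)
    then have "ereal (l1 / real n) < rate x"
      using n by (cases "rate x") (auto simp: field_simps)
    then obtain \<theta> where \<theta>: "\<theta> \<ge> 0" "\<Lambda> \<theta> < ereal (\<theta> * x - l1 / real n)"
      using less_rate_exponent[OF x, of "l1 / real n"] l1'(2) by (metis divide_nonneg_nonneg less_imp_le of_nat_0_le_iff)
    show ?thesis
      using mgf_less[OF \<theta>(2)] eventually_ge_1
    proof eventually_elim
      case (elim N)
      show ?case
      proof
        fix i
        have "measure (M N) (?E N i n) \<le> exp (- G N * (\<theta> * (r * (real n + slack)) - real (card {int i - int n<..int i}) * (\<theta> * x - l1 / real n)))"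
          using elim \<theta>(1) by (intro chernoff) auto
        also have "\<theta> * (r * (real n + slack)) - real (card {int i - int n<..int i}) * (\<theta> * x - l1 / real n) = l1"
          unfolding nx[symmetric] using n by (simp add: right_diff_distrib mult.left_commute)
        finally show "measure (M N) (?E N i n) \<le> exp (- l1 * G N)" by (simp add: mult.commute)
      qed
    qed
  qed
  have head': "\<forall>\<^sub>F N in sequentially. \<forall>n\<in>windows D T \<inter> {..<n0}. \<forall>i. measure (M N) (?E N i n) \<le> exp (- l1 * G N)"
    by (intro eventually_ball_finite ballI head) auto
  have "\<forall>\<^sub>F N in sequentially. 2 \<le> exp (\<delta> * G N)" by (rule const_le_exp_G[OF \<theta>0(2)])
  moreover have "\<forall>\<^sub>F N in sequentially. real n0 + 2 \<le> exp ((l1 - l) * G N)"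
    using l1'(1) by (intro const_le_exp_G) simp
  ultimately show ?thesis
    unfolding decays_at_least_def
    using head' mgf_less[OF \<theta>0(3)] eventually_ge_1
  proof eventually_elim
    case (elim N)
    interpret D: delay_setting "M N" "A N" "r * real N" T D
      by (rule delay_setting[OF elim(5) r])
    have G: "G N > 0" by (rule G_pos[OF elim(5)])
    have E: "D.overload i n = ?E N i n" for i n
      by (simp add: D.overload_def mult.assoc mult.left_commute[of r])
    define q where "q = exp (- (\<delta> * G N))"
    have q: "0 < q" "q \<le> 1 / 2" using elim(1) by (auto simp: q_def exp_minus field_simps)
    have tail: "measure (M N) (D.overload i n) \<le> q ^ n" for i n
    proof -
      have "measure (M N) (D.overload i n) \<le> exp (- G N * (\<theta>0 * (r * (real n + slack)) - real (card {int i - int n<..int i}) * (\<theta>0 * r - \<delta>)))"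
        unfolding E using elim(4,5) \<theta>0(1) by (intro chernoff) auto
      also have "\<dots> \<le> exp (- G N * (real n * \<delta>))"
      proof -
        have "0 \<le> \<theta>0 * (r * slack)" using \<theta>0(1) r lam_pos slack_pos by simp
        then have "real n * \<delta> \<le> \<theta>0 * (r * (real n + slack)) - real (card {int i - int n<..int i}) * (\<theta>0 * r - \<delta>)"
          by (simp add: algebra_simps)
        then show ?thesis using G by simp
      qed
      also have "\<dots> = q ^ n" by (simp add: q_def exp_of_nat_mult[symmetric] mult_ac)
      finally show ?thesis .
    qed
    have qn0: "q ^ n0 \<le> exp (- l1 * G N)"
      using mult_right_mono[OF n0, of "G N"] G by (simp add: q_def exp_of_nat_mult[symmetric] mult_ac)
    have viol: "D.viol i \<le> (real n0 + 2) * exp (- l1 * G N)" if "i < T" for i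
    proof -
      have "D.viol i \<le> measure (M N) (\<Union>n\<in>windows D T. D.overload i n)" by (rule D.viol_le[OF that])
      also have "\<dots> \<le> real n0 * exp (- l1 * G N) + 2 * q ^ n0"
        using elim(3) by (intro D.prob_overload_Union_le q tail) (auto simp: E)
      also have "\<dots> \<le> (real n0 + 2) * exp (- l1 * G N)" using qn0 by (simp add: algebra_simps)
      finally show ?thesis .
    qed
    have "(\<Sum>i<T. D.viol i) \<le> (\<Sum>i<T. (real n0 + 2) * exp (- l1 * G N))"
      by (intro sum_mono viol) simp
    then have "delay_prob M A D r T N \<le> (real n0 + 2) * exp (- l1 * G N)"
      using T_pos by (simp add: delay_prob_def field_simps)
    also have "\<dots> \<le> exp ((l1 - l) * G N) * exp (- l1 * G N)"
      using elim(2) by (intro mult_right_mono) auto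
    also have "\<dots> = exp (- l * G N)" by (simp add: exp_add[symmetric] algebra_simps)
    finally show ?case .
  qed
qed

text \<open>The strict inequality \<open>r < r2\<close> opens an interval between the per-slot
  thresholds \<open>x\<close> and \<open>y\<close>. Slots inside it overload the window at load
  \<open>r\<close>, while their cost is that of \<open>y\<close>, which is what \<open>I r2\<close>
  counts.\<close>

lemma delay_prob_lower_bound:
  assumes r: "lam < r" "r < r2" and l: "I r2 < ereal l"
  shows "decays_at_most (delay_prob M A D r T) G l"
proof -
  obtain n where nw: "n \<in> windows D T" and I: "ereal (real n) * rate (r2 + slack * r2 / real n) < ereal l"
    using l unfolding I_fun_windows INF_less_iff by blast
  have n: "n \<ge> 1" by (rule window_pos[OF nw])
  define x y where "x = r + slack * r / real n" and "y = r2 + slack * r2 / real n"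
  have nx: "real n * x = r * (real n + slack)" unfolding x_def by (rule threshold_eq[OF n])
  have "r \<le> x" using slack_pos r lam_pos by (simp add: x_def)
  then have x: "lam < x" using r by simp
  have "slack * r / real n \<le> slack * r2 / real n"
    using slack_pos r by (intro divide_right_mono mult_left_mono) auto
  then have xy: "x < y" using r by (simp add: x_def y_def)
  have y: "y > 0" using x xy lam_pos by simp
  have "rate y < ereal (l / real n)"
    using I n unfolding y_def[symmetric] by (cases "rate y") (auto simp: field_simps)
  then obtain l3 where l3: "rate y < ereal l3" "l3 < l / real n"
    using ereal_dense2[of "rate y" "ereal (l / real n)"] by auto
  \<comment> \<open>Spare exponent that pays for the factor \<open>T * y * N\<close>:
    \<open>T\<close> from averaging over slots, \<open>y * N\<close> from picking a random
    bit.\<close>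
  have slackl: "l - real n * l3 > 0" using l3(2) n by (simp add: field_simps)
  \<comment> \<open>The slot at which overload of a window from \<open>windows\<close> implies
    lateness.\<close>
  define i where "i = T - 1 - D mod T"
  have iT: "i < T" using T_pos by (simp add: i_def)
  show ?thesis
    unfolding decays_at_most_def
    using gap_prob_lower_bound[OF x xy l3(1)] linear_le_exp_G[OF slackl, of "real T * y"] eventually_ge_1
  proof eventually_elim
    case (elim N)
    interpret D: delay_setting "M N" "A N" "r * real N" T D
      by (rule delay_setting[OF elim(3) r(1)])
    let ?K = "{k. x * real N < real k \<and> real k < y * real N}"
    let ?J = "{int i - int n<..int i}"
    define V where "V = (\<Inter>t\<in>?J. A N t -` ?K \<inter> space (M N))"
    have J: "?J \<noteq> {}" "finite ?J" "int i \<in> ?J" "card ?J = n" using n by auto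
    have "D.prob V = (\<Prod>t\<in>?J. D.prob (A N t -` ?K \<inter> space (M N)))"
      unfolding V_def by (rule D.indep_varsD[OF indep_A[OF elim(3)] J(1,2)]) auto
    also have "\<dots> = (\<Prod>t\<in>?J. gap_prob N x y)"
    proof (rule prod.cong[OF refl])
      fix t
      have "A N t -` ?K \<inter> space (M N) = {\<omega>\<in>space (M N). A N t \<omega> \<in> ?K}" by auto
      then show "D.prob (A N t -` ?K \<inter> space (M N)) = gap_prob N x y"
        using measure_A[OF elim(3), of t ?K] by (simp only: gap_prob_def)
    qed
    finally have V: "D.prob V = gap_prob N x y ^ n" using J by simp
    have V_sets: "V \<in> sets (M N)"
      unfolding V_def using J by (intro sets.finite_INT) (auto intro!: measurable_sets[OF measurable_A[OF elim(3)]])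
    have yN: "y * real N > 0" using y elim(3) by simp
    have "D.prob V / (y * real N) \<le> D.viol i"
    proof (rule D.viol_ge[OF iT V_sets yN])
      fix \<omega> assume \<omega>: "\<omega> \<in> V"
      then have K: "A N t \<omega> \<in> ?K" if "t \<in> ?J" for t using that by (auto simp: V_def)
      have "x * real N \<ge> 0" using x lam_pos by simp
      then have "0 < A N (int i) \<omega>" using K[OF J(3)] by (auto simp: zero_less_iff_neq_zero)
      moreover have "real (A N (int i) \<omega>) \<le> y * real N" using K[OF J(3)] by simp
      moreover have "(\<Sum>t\<in>?J. x * real N) < (\<Sum>t\<in>?J. real (A N t \<omega>))"
        using J K by (intro sum_strict_mono) auto
      then have "r * real N * (real n + slack) < (\<Sum>t\<in>?J. real (A N t \<omega>))"
        using J(4) nx by (simp add: mult_ac) (metis mult.assoc mult.commute)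
      then have "D.late i (A N (int i) \<omega>) \<omega>"
        unfolding D.late_def
        by (intro window_imp_delay[OF T_pos T_le D.b_pos i_def nw])
      ultimately show "1 \<le> A N (int i) \<omega> \<and> real (A N (int i) \<omega>) \<le> y * real N \<and> D.late i (A N (int i) \<omega>) \<omega>"
        by simp
    qed
    also have "\<dots> \<le> (\<Sum>i<T. D.viol i)" using iT by (intro member_le_sum D.viol_nonneg) auto
    finally have ge: "gap_prob N x y ^ n / (real T * y * real N) \<le> delay_prob M A D r T N"
      unfolding V delay_prob_def using T_pos by (simp add: field_simps)
    have "exp (- l * G N) * (real T * y * real N) \<le> exp (- l * G N) * exp ((l - real n * l3) * G N)"
      using elim(2) by (intro mult_left_mono) auto
    also have "\<dots> = exp (- l3 * G N) ^ n"
      by (simp add: exp_add[symmetric] exp_of_nat_mult[symmetric] algebra_simps)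
    also have "\<dots> \<le> gap_prob N x y ^ n" by (intro power_mono elim(1)) simp
    finally have "exp (- l * G N) \<le> gap_prob N x y ^ n / (real T * y * real N)"
      using yN T_pos by (simp add: pos_le_divide_eq mult.assoc)
    with ge show ?case by simp
  qed
qed

end

end

section \<open>Decay of the total error probability\<close>

lemma ereal_mult_less_iff: "0 < \<gamma> \<Longrightarrow> ereal \<gamma> * x < ereal l \<longleftrightarrow> x < ereal (l / \<gamma>)"
  by (cases x) (auto simp: field_simps)

lemma ereal_less_mult_iff: "0 < \<gamma> \<Longrightarrow> ereal l < ereal \<gamma> * x \<longleftrightarrow> ereal (l / \<gamma>) < x"
  by (cases x) (auto simp: field_simps)

lemma ereal_le_from_above: "(\<And>l. x < ereal l \<Longrightarrow> y \<le> ereal l) \<Longrightarrow> y \<le> x"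
  by (meson ereal_dense2 not_le)

lemma decays_at_least_speed:
  assumes s: "filterlim s at_top sequentially" and \<kappa>: "(\<lambda>N. a N / s N) \<longlonglongrightarrow> \<kappa>"
    and q: "decays_at_least q a l1" and l: "l < \<kappa> * l1"
  shows "decays_at_least q s l"
proof -
  have "\<forall>\<^sub>F N in sequentially. 0 < s N" using s by (simp add: filterlim_at_top_dense)
  moreover have "\<forall>\<^sub>F N in sequentially. l < a N / s N * l1"
    by (rule order_tendstoD(1)[OF tendsto_mult_right[OF \<kappa>] l])
  ultimately show ?thesis
    using q unfolding decays_at_least_def
  proof eventually_elim
    case (elim N)
    then have "l * s N \<le> l1 * a N" by (simp add: field_simps)
    then have "exp (- l1 * a N) \<le> exp (- l * s N)" by simp
    with elim show ?case by linarith
  qed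
qed

lemma decays_at_most_speed:
  assumes s: "filterlim s at_top sequentially" and \<kappa>: "(\<lambda>N. a N / s N) \<longlonglongrightarrow> \<kappa>"
    and q: "decays_at_most q a l1" and l: "\<kappa> * l1 < l"
  shows "decays_at_most q s l"
proof -
  have "\<forall>\<^sub>F N in sequentially. 0 < s N" using s by (simp add: filterlim_at_top_dense)
  moreover have "\<forall>\<^sub>F N in sequentially. a N / s N * l1 < l"
    by (rule order_tendstoD(2)[OF tendsto_mult_right[OF \<kappa>] l])
  ultimately show ?thesis
    using q unfolding decays_at_most_def
  proof eventually_elim
    case (elim N)
    then have "l1 * a N \<le> l * s N" by (simp add: field_simps)
    then have "exp (- l * s N) \<le> exp (- l1 * a N)" by simp
    with elim show ?case by linarith
  qed
qed

text \<open>When the speed \<open>a\<close> dominates \<open>s\<close>, any positive exponent at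
  \<open>a\<close> becomes an arbitrarily large one at \<open>s\<close>; this is how the faster of
  the two errors drops out.\<close>

lemma decays_at_least_faster:
  assumes s: "filterlim s at_top sequentially" and fast: "filterlim (\<lambda>N. a N / s N) at_top sequentially"
    and q: "decays_at_least q a l1" and l1: "0 < l1"
  shows "decays_at_least q s l"
proof -
  have "\<forall>\<^sub>F N in sequentially. 0 < s N" using s by (simp add: filterlim_at_top_dense)
  moreover have "\<forall>\<^sub>F N in sequentially. l / l1 \<le> a N / s N" using fast by (simp add: filterlim_at_top)
  ultimately show ?thesis
    using q unfolding decays_at_least_def
  proof eventually_elim
    case (elim N)
    then have "l * s N \<le> l1 * a N" using l1 by (simp add: field_simps)
    then have "exp (- l1 * a N) \<le> exp (- l * s N)" by simp
    with elim show ?case by linarith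
  qed
qed

section \<open>Combining channel and delay errors at fixed \<open>r\<close> and
  \<open>T\<close>\<close>

locale transmission = smooth_source g lam M A \<Lambda>
  for g :: "real \<Rightarrow> real" and lam :: real and M :: "nat \<Rightarrow> 'a measure"
    and A :: "nat \<Rightarrow> int \<Rightarrow> 'a \<Rightarrow> nat" and \<Lambda> :: "real \<Rightarrow> ereal" +
  fixes P_ch :: "real \<Rightarrow> nat \<Rightarrow> real \<Rightarrow> real" and d_ch :: "real \<Rightarrow> nat \<Rightarrow> real"
    and r_max :: real and D T :: nat and r :: real
  assumes channel: "channel P_ch d_ch r_max"
    and T_pos: "1 \<le> T" and T_le: "2 * T \<le> D" and r_gt: "lam < r" and r_less: "r < r_max"
begin

definition ch_err :: "nat \<Rightarrow> real" where "ch_err N = P_ch r T (exp (real N))"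

abbreviation "delay_err \<equiv> delay_prob M A D r T"
abbreviation "tot_err \<equiv> total_error_prob P_ch M A D r T"
abbreviation "d \<equiv> d_ch r T"
abbreviation "J x \<equiv> I_fun D \<Lambda> x T"

lemma r_in: "r \<in> {0..r_max}" using r_gt r_less lam_pos by simp

lemma tot_err_eq: "tot_err N = ch_err N + (1 - ch_err N) * delay_err N"
  by (simp add: total_error_prob_def ch_err_def Let_def)

lemma ch_err_bounds: "N \<ge> 1 \<Longrightarrow> 0 \<le> ch_err N \<and> ch_err N \<le> 1"
  using channel r_in T_pos unfolding channel_def ch_err_def by (auto simp del: Ball_def)

lemma delay_err_nonneg: "N \<ge> 1 \<Longrightarrow> 0 \<le> delay_err N"
  by (rule delay_prob_nonneg[OF T_pos T_le _ r_gt])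

lemma d_pos: "0 < d"
proof -
  have "antimono_on {0..r_max} (\<lambda>r. d_ch r T)" "d_ch r_max T = 0" "d_ch r T \<noteq> 0"
    using channel T_pos r_in r_less unfolding channel_def by auto
  moreover have "d_ch r_max T \<le> d_ch r T"
    using monotone_onD[OF calculation(1) r_in, of r_max] r_in r_less by simp
  ultimately show ?thesis by simp
qed

lemma ch_err_tendsto: "(\<lambda>N. - eln (ennreal (ch_err N)) / ereal (real N)) \<longlonglongrightarrow> ereal d"
proof -
  have "((\<lambda>\<rho>. - (eln (ennreal (P_ch r T \<rho>)) / ereal (ln \<rho>))) \<longlongrightarrow> ereal d) at_top"
    using channel T_pos r_in unfolding channel_def by blast
  moreover have "filterlim (\<lambda>N. exp (real N)) at_top sequentially"
    by (rule filterlim_compose[OF exp_at_top filterlim_real_sequentially])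
  ultimately have "(\<lambda>N. - (eln (ennreal (P_ch r T (exp (real N)))) / ereal (ln (exp (real N))))) \<longlonglongrightarrow> ereal d"
    by (rule filterlim_compose)
  moreover have "- (x / ereal c) = - x / ereal c" for x c by (simp add: divide_ereal_def)
  ultimately show ?thesis by (simp only: ch_err_def ln_exp)
qed

lemma ch_err_at_least:
  assumes "l < d"
  shows "decays_at_least ch_err real l"
proof -
  have "\<forall>\<^sub>F N in sequentially. ereal l < - eln (ennreal (ch_err N)) / ereal (real N)"
    using assms by (intro order_tendstoD(1)[OF ch_err_tendsto]) simp
  then show ?thesis
    unfolding decays_at_least_def using eventually_ge_1
  proof eventually_elim
    case (elim N)
    then show ?case using less_exponent_iff[of "real N" l "ch_err N"] by simp
  qed
qed

lemma ch_err_at_most: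
  assumes "d < l"
  shows "decays_at_most ch_err real l"
proof -
  have "\<forall>\<^sub>F N in sequentially. - eln (ennreal (ch_err N)) / ereal (real N) < ereal l"
    using assms by (intro order_tendstoD(2)[OF ch_err_tendsto]) simp
  then show ?thesis
    unfolding decays_at_most_def using eventually_ge_1
  proof eventually_elim
    case (elim N)
    then show ?case using exponent_less_iff[of "real N" "ch_err N" l] by simp
  qed
qed

text \<open>Keeps the factor \<open>1 - ch_err N\<close> away from 0, so that delay violations show
  up in the total error.\<close>

lemma ch_err_le_half: "\<forall>\<^sub>F N in sequentially. ch_err N \<le> 1 / 2"
proof -
  have "decays_at_least ch_err real (d / 2)" using d_pos by (intro ch_err_at_least) simp
  moreover have "\<forall>\<^sub>F N in sequentially. real N \<ge> ln 2 / (d / 2)"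
    using filterlim_real_sequentially unfolding filterlim_at_top by blast
  ultimately show ?thesis
    unfolding decays_at_least_def
  proof eventually_elim
    case (elim N)
    then have "ln 2 \<le> d / 2 * real N" using d_pos by (simp add: field_simps)
    then have "exp (- (d / 2) * real N) \<le> exp (- ln 2)" by simp
    with elim show ?case by (simp add: exp_minus)
  qed
qed

lemma tot_err_at_least:
  assumes s: "filterlim s at_top sequentially"
    and p: "decays_at_least ch_err s l1" and q: "decays_at_least delay_err s l1" and l: "l < l1"
  shows "decays_at_least tot_err s l"
proof -
  have "\<forall>\<^sub>F N in sequentially. s N \<ge> ln 2 / (l1 - l)" using s by (simp add: filterlim_at_top)
  then show ?thesis
    using p q eventually_ge_1 unfolding decays_at_least_def
  proof eventually_elim
    case (elim N)
    then have "ln 2 \<le> (l1 - l) * s N" using l by (simp add: field_simps)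
    then have "exp (ln 2) \<le> exp ((l1 - l) * s N)" by (subst exp_le_cancel_iff)
    then have "2 * exp (- l1 * s N) \<le> exp ((l1 - l) * s N) * exp (- l1 * s N)"
      by (intro mult_right_mono) auto
    also have "\<dots> = exp (- l * s N)" by (simp add: exp_add[symmetric] algebra_simps)
    finally have "2 * exp (- l1 * s N) \<le> exp (- l * s N)" .
    moreover have "(1 - ch_err N) * delay_err N \<le> 1 * delay_err N"
      using ch_err_bounds[OF elim(4)] delay_err_nonneg[OF elim(4)] by (intro mult_right_mono) auto
    ultimately show ?case using elim by (simp add: tot_err_eq)
  qed
qed

lemma tot_err_at_most_ch:
  assumes "decays_at_most ch_err s l"
  shows "decays_at_most tot_err s l"
  using assms eventually_ge_1 unfolding decays_at_most_def
proof eventually_elim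
  case (elim N)
  have "0 \<le> (1 - ch_err N) * delay_err N"
    using ch_err_bounds[OF elim(2)] delay_err_nonneg[OF elim(2)] by simp
  with elim show ?case by (simp add: tot_err_eq)
qed

lemma tot_err_at_most_delay:
  assumes s: "filterlim s at_top sequentially" and q: "decays_at_most delay_err s l1" and l: "l1 < l"
  shows "decays_at_most tot_err s l"
proof -
  have "\<forall>\<^sub>F N in sequentially. s N \<ge> ln 2 / (l - l1)" using s by (simp add: filterlim_at_top)
  then show ?thesis
    using q eventually_ge_1 ch_err_le_half unfolding decays_at_most_def
  proof eventually_elim
    case (elim N)
    then have "ln 2 \<le> (l - l1) * s N" using l by (simp add: field_simps)
    then have "exp (ln 2) \<le> exp ((l - l1) * s N)" by (subst exp_le_cancel_iff)
    then have "2 * exp (- l * s N) \<le> exp ((l - l1) * s N) * exp (- l * s N)"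
      by (intro mult_right_mono) auto
    also have "\<dots> = exp (- l1 * s N)" by (simp add: exp_add[symmetric] algebra_simps)
    finally have "exp (- l * s N) \<le> 1 / 2 * delay_err N" using elim(2) by simp
    also have "\<dots> \<le> (1 - ch_err N) * delay_err N"
      using elim(4) delay_err_nonneg[OF elim(3)] by (intro mult_right_mono) auto
    finally show ?case using ch_err_bounds[OF elim(3)] by (simp add: tot_err_eq)
  qed
qed

lemmas delay_at_least = delay_prob_upper_bound[OF T_pos T_le r_gt]
lemmas delay_at_most = delay_prob_lower_bound[OF T_pos T_le r_gt]
lemmas J_pos = I_pos[OF T_pos T_le]

text \<open>At a continuity point, the loss from passing to \<open>r2 > r\<close> in the lower bound
  on the delay probability can be made arbitrarily small.\<close>

lemma J_right_limit:
  assumes "isCont J r" "J r < l"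
  obtains r2 where "r < r2" "J r2 < l"
proof -
  have "\<forall>\<^sub>F x in at r. J x < l"
    using assms unfolding isCont_def by (rule order_tendstoD(2))
  then obtain e where "e > 0" "\<And>x. x \<noteq> r \<Longrightarrow> dist x r < e \<Longrightarrow> J x < l"
    by (auto simp: eventually_at)
  then show ?thesis using that[of "r + e / 2"] by (simp add: dist_real_def)
qed

lemma tot_err_at_most_d: "d < l \<Longrightarrow> decays_at_most tot_err real l"
  by (intro tot_err_at_most_ch ch_err_at_most)

lemma proportional_at_least:
  assumes \<gamma>: "0 < \<gamma>" "(\<lambda>N. G N / real N) \<longlonglongrightarrow> \<gamma>"
    and l: "l < d" "ereal l < ereal \<gamma> * J r"
  shows "decays_at_least tot_err real l"
proof -
  have "ereal l < min (ereal d) (ereal \<gamma> * J r)" using l by simp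
  from ereal_dense2[OF this] obtain l1 where "ereal l < ereal l1" "ereal l1 < min (ereal d) (ereal \<gamma> * J r)"
    by blast
  then have l1: "l < l1" "l1 < d" "ereal l1 < ereal \<gamma> * J r" by auto
  then obtain l2 where l2: "l1 / \<gamma> < l2" "ereal l2 < J r"
    using ereal_dense2[of "ereal (l1 / \<gamma>)" "J r"] \<gamma>(1) by (auto simp: ereal_less_mult_iff)
  have "l1 < \<gamma> * l2" using l2 \<gamma> by (simp add: field_simps)
  then show ?thesis
    by (intro tot_err_at_least[OF filterlim_real_sequentially ch_err_at_least[OF l1(2)] _ l1(1)]
        decays_at_least_speed[OF filterlim_real_sequentially \<gamma>(2) delay_at_least[OF l2(2)]])
qed

lemma proportional_at_most:
  assumes \<gamma>: "0 < \<gamma>" "(\<lambda>N. G N / real N) \<longlonglongrightarrow> \<gamma>"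
    and l: "r < r2" "ereal \<gamma> * J r2 < ereal l"
  shows "decays_at_most tot_err real l"
proof -
  obtain l1 where l1: "ereal \<gamma> * J r2 < ereal l1" "l1 < l"
    using ereal_dense2[OF l(2)] by auto
  then obtain l2 where l2: "J r2 < ereal l2" "l2 < l1 / \<gamma>"
    using ereal_dense2[of "J r2" "ereal (l1 / \<gamma>)"] \<gamma>(1) by (auto simp: ereal_mult_less_iff)
  have "\<gamma> * l2 < l1" using l2 \<gamma> by (simp add: field_simps)
  then show ?thesis
    by (intro tot_err_at_most_delay[OF filterlim_real_sequentially _ l1(2)]
        decays_at_most_speed[OF filterlim_real_sequentially \<gamma>(2) delay_at_most[OF l(1) l2(1)]])
qed

lemma proportional_exponent:
  assumes \<gamma>: "0 < \<gamma>" "(\<lambda>N. G N / real N) \<longlonglongrightarrow> \<gamma>" and cont: "isCont J r"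
  shows "decay_exponent tot_err real (min (ereal d) (ereal \<gamma> * J r))"
proof (rule decay_exponentI[OF filterlim_real_sequentially])
  fix l assume "ereal l < min (ereal d) (ereal \<gamma> * J r)"
  then show "decays_at_least tot_err real l" by (intro proportional_at_least[OF \<gamma>]) auto
next
  fix l assume "min (ereal d) (ereal \<gamma> * J r) < ereal l"
  then consider "d < l" | "ereal \<gamma> * J r < ereal l" by (auto simp: min_def split: if_splits)
  then show "decays_at_most tot_err real l"
  proof cases
    case 2
    then have "J r < ereal (l / \<gamma>)" using \<gamma>(1) by (simp add: ereal_mult_less_iff)
    then obtain r2 where "r < r2" "J r2 < ereal (l / \<gamma>)" by (rule J_right_limit[OF cont])
    then show ?thesis using \<gamma>(1) by (intro proportional_at_most[OF \<gamma>, of r2]) (auto simp: ereal_mult_less_iff)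
  qed (rule tot_err_at_most_d)
qed

lemma slow_at_most:
  assumes l: "r < r2" "J r2 < ereal l"
  shows "decays_at_most tot_err G l"
proof -
  obtain l1 where "J r2 < ereal l1" "l1 < l" using ereal_dense2[OF l(2)] by auto
  then show ?thesis
    by (intro tot_err_at_most_delay[OF G_at_top delay_at_most[OF l(1)]])
qed

text \<open>At speed \<open>G\<close>, slower than \<open>N\<close>, the channel error decays with
  every exponent, so only the delay counts.\<close>

lemma slow_exponent:
  assumes slow: "(\<lambda>N. G N / real N) \<longlonglongrightarrow> 0" and cont: "isCont J r"
  shows "decay_exponent tot_err G (J r)"
proof (rule decay_exponentI[OF G_at_top])
  fix l assume l: "ereal l < J r"
  obtain l1 where l1: "l < l1" "ereal l1 < J r" using ereal_dense2[OF l] by auto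
  have "\<forall>\<^sub>F N in sequentially. 0 < G N / real N"
    using eventually_ge_1 by eventually_elim (simp add: G_pos)
  then have "filterlim (\<lambda>N. inverse (G N / real N)) at_top sequentially"
    by (rule filterlim_inverse_at_top[OF slow])
  then have fast: "filterlim (\<lambda>N. real N / G N) at_top sequentially" by simp
  have "decays_at_least ch_err G l1"
    using d_pos by (intro decays_at_least_faster[OF G_at_top fast ch_err_at_least[of "d / 2"]]) auto
  then show "decays_at_least tot_err G l"
    by (rule tot_err_at_least[OF G_at_top _ delay_at_least[OF l1(2)] l1(1)])
next
  fix l assume "J r < ereal l"
  then obtain r2 where "r < r2" "J r2 < ereal l" by (rule J_right_limit[OF cont])
  then show "decays_at_most tot_err G l" by (rule slow_at_most)
qed

lemma fast_exponent:
  assumes fast: "filterlim (\<lambda>N. G N / real N) at_top sequentially"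
  shows "decay_exponent tot_err real (ereal d)"
proof (rule decay_exponentI[OF filterlim_real_sequentially])
  fix l assume "ereal l < ereal d"
  then obtain l1 where l1: "l < l1" "l1 < d" using dense by auto
  obtain l2 where l2: "0 < l2" "ereal l2 < J r"
    using ereal_dense2[OF J_pos[OF r_gt]] by auto
  have "decays_at_least delay_err real l1"
    by (rule decays_at_least_faster[OF filterlim_real_sequentially fast delay_at_least[OF l2(2)] l2(1)])
  then show "decays_at_least tot_err real l"
    by (rule tot_err_at_least[OF filterlim_real_sequentially ch_err_at_least[OF l1(2)] _ l1(1)])
qed (simp add: tot_err_at_most_d)

lemma exponent_le_d:
  assumes "decay_exponent tot_err real L"
  shows "L \<le> ereal d"
  by (rule ereal_le_from_above) (auto intro!: decay_exponent_le[OF filterlim_real_sequentially assms] tot_err_at_most_d)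

end

section \<open>The crossing of the delay and channel exponents\<close>

lemma (in smooth_source) crossings_unique:
  assumes T: "1 \<le> T" "2 * T \<le> D" and channel: "channel P_ch d_ch r_max" and \<gamma>: "0 < \<gamma>"
    and r1: "r1 \<in> crossings D \<Lambda> d_ch lam r_max \<gamma> T" and r2: "r2 \<in> crossings D \<Lambda> d_ch lam r_max \<gamma> T"
  shows "r1 = r2"
proof -
  have "\<not> r1 < r2" if r1: "r1 \<in> crossings D \<Lambda> d_ch lam r_max \<gamma> T"
    and r2: "r2 \<in> crossings D \<Lambda> d_ch lam r_max \<gamma> T" for r1 r2
  proof
    assume less: "r1 < r2"
    let ?J = "\<lambda>r. I_fun D \<Lambda> r T"
    have in1: "lam < r1" "r1 < r_max" "ereal \<gamma> * ?J r1 = ereal (d_ch r1 T)"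
      and in2: "lam < r2" "r2 < r_max" "ereal \<gamma> * ?J r2 = ereal (d_ch r2 T)"
      using r1 r2 by (auto simp: crossings_def)
    have "antimono_on {0..r_max} (\<lambda>r. d_ch r T)" using channel T unfolding channel_def by blast
    from monotone_onD[OF this, of r1 r2] have le: "d_ch r2 T \<le> d_ch r1 T"
      using in1 in2 less lam_pos by simp
    \<comment> \<open>A crossing forces \<open>I_fun\<close> to be finite there; with
      \<open>j1 > 0\<close> the growth by the factor \<open>r2 / r1 > 1\<close> is strict.\<close>
    obtain j1 where j1: "?J r1 = ereal j1" using in1(3) \<gamma> by (cases "?J r1") auto
    obtain j2 where j2: "?J r2 = ereal j2" using in2(3) \<gamma> by (cases "?J r2") auto
    have "j1 > 0" using I_pos[OF T in1(1)] j1 by simp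
    moreover have "r2 / r1 * j1 \<le> j2" using I_scaled[OF T in1(1), of r2] less j1 j2 by simp
    moreover have "1 * j1 < r2 / r1 * j1"
      using less in1(1) lam_pos \<open>j1 > 0\<close> by (intro mult_strict_right_mono) auto
    ultimately have "\<gamma> * j1 < \<gamma> * j2" using \<gamma> by simp
    then show False using in1(3) in2(3) j1 j2 le by simp
  qed
  from this[OF r1 r2] this[OF r2 r1] show ?thesis by simp
qed

text \<open>The crossing set is a singleton, so its \<open>Inf\<close> is a member even if
  \<open>I_fun\<close> jumps.\<close>

lemma (in smooth_source) r_star_in_crossings:
  assumes "1 \<le> T" "2 * T \<le> D" "channel P_ch d_ch r_max" "0 < \<gamma>"
    and ne: "crossings D \<Lambda> d_ch lam r_max \<gamma> T \<noteq> {}"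
  shows "r_star D \<Lambda> d_ch lam r_max \<gamma> T \<in> crossings D \<Lambda> d_ch lam r_max \<gamma> T"
proof -
  obtain x where x: "x \<in> crossings D \<Lambda> d_ch lam r_max \<gamma> T" using ne by blast
  then have "crossings D \<Lambda> d_ch lam r_max \<gamma> T = {x}" using crossings_unique[OF assms(1-4)] by blast
  then show ?thesis by (simp add: r_star_def)
qed

theorem theorem1:
  fixes D :: nat and g :: "real \<Rightarrow> real" and lam r_max :: real
    and M :: "nat \<Rightarrow> 'a measure" and A :: "nat \<Rightarrow> int \<Rightarrow> 'a \<Rightarrow> nat" and \<Lambda> :: "real \<Rightarrow> ereal"
    and P_ch :: "real \<Rightarrow> nat \<Rightarrow> real \<Rightarrow> real" and d_ch :: "real \<Rightarrow> nat \<Rightarrow> real"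
  assumes "D \<ge> 2"
    and "scaling_function g"
    and "0 < lam" and "lam < r_max"
    and "smoothly_scaling_source g lam M A \<Lambda>"
    and "channel P_ch d_ch r_max"
  shows
    "(\<forall>\<gamma>>0. (\<lambda>N. g (real N) / real N) \<longlonglongrightarrow> \<gamma> \<longrightarrow>
        (\<forall>r\<in>{lam<..<r_max}. \<forall>T\<in>{1..D div 2}. isCont (\<lambda>x. I_fun D \<Lambda> x T) r \<longrightarrow>
           (\<exists>L. decay_exponent (total_error_prob P_ch M A D r T) real L)) \<and>
        ((\<forall>T\<in>{1..D div 2}. crossings D \<Lambda> d_ch lam r_max \<gamma> T \<noteq> {}) \<longrightarrow>
           (\<forall>T'. is_arg_max (\<lambda>T. I_fun D \<Lambda> (r_star D \<Lambda> d_ch lam r_max \<gamma> T) T)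
                            (\<lambda>T. T \<in> {1..D div 2}) T' \<longrightarrow>
              (let r' = r_star D \<Lambda> d_ch lam r_max \<gamma> T' in
                 Sup {L. \<exists>r\<in>{lam<..<r_max}. \<exists>T\<in>{1..D div 2}.
                        decay_exponent (total_error_prob P_ch M A D r T) real L}
                   = ereal (d_ch r' T') \<and>
                 ereal (d_ch r' T') = ereal \<gamma> * I_fun D \<Lambda> r' T'))))
     \<and>
     ((\<lambda>N. g (real N) / real N) \<longlonglongrightarrow> 0 \<and>
      filterlim (\<lambda>N. g (real N) / ln (real N)) at_top sequentially \<longrightarrow>
        (\<forall>r\<in>{lam<..<r_max}. \<forall>T\<in>{1..D div 2}. isCont (\<lambda>x. I_fun D \<Lambda> x T) r \<longrightarrow>
           (\<exists>L. decay_exponent (total_error_prob P_ch M A D r T) (\<lambda>N. g (real N)) L)) \<and>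
        Sup {L. \<exists>r\<in>{lam<..<r_max}. \<exists>T\<in>{1..D div 2}.
               decay_exponent (total_error_prob P_ch M A D r T) (\<lambda>N. g (real N)) L}
          \<le> Max (I_fun D \<Lambda> r_max ` {1..D div 2}))
     \<and>
     (filterlim (\<lambda>N. g (real N) / real N) at_top sequentially \<longrightarrow>
        (\<forall>r\<in>{lam<..<r_max}. \<forall>T\<in>{1..D div 2}.
           \<exists>L. decay_exponent (total_error_prob P_ch M A D r T) real L) \<and>
        Sup {L. \<exists>r\<in>{lam<..<r_max}. \<exists>T\<in>{1..D div 2}.
               decay_exponent (total_error_prob P_ch M A D r T) real L}
          \<le> ereal (d_ch lam (D div 2)))"
    (is "?case1 \<and> ?case2 \<and> ?case3")
proof -
  interpret smooth_source g lam M A \<Lambda>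
    by (rule smooth_source.intro) fact+
  let ?tot = "\<lambda>r T. total_error_prob P_ch M A D r T"
  have transmission: "transmission g lam M A \<Lambda> P_ch d_ch r_max D T r"
    if "r \<in> {lam<..<r_max}" "T \<in> {1..D div 2}" for r T
    using that assms(6) by unfold_locales auto
  have T_bounds: "1 \<le> T" "2 * T \<le> D" if "T \<in> {1..D div 2}" for T
    using that by auto
  have antimono: "d_ch s T \<le> d_ch r T" if "r \<in> {0..r_max}" "s \<in> {0..r_max}" "r \<le> s" "1 \<le> T" for r s T
  proof -
    have "antimono_on {0..r_max} (\<lambda>r. d_ch r T)"
      using assms(6) that(4) unfolding channel_def by blast
    from monotone_onD[OF this that(1-3)] show ?thesis by simp
  qed
  have ?case1
  proof (intro allI impI conjI ballI)
    fix \<gamma> r :: real and T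
    assume \<gamma>: "\<gamma> > 0" "(\<lambda>N. G N / real N) \<longlonglongrightarrow> \<gamma>"
      and rT: "r \<in> {lam<..<r_max}" "T \<in> {1..D div 2}" and cont: "isCont (\<lambda>x. I_fun D \<Lambda> x T) r"
    then show "\<exists>L. decay_exponent (?tot r T) real L"
      using transmission.proportional_exponent[OF transmission[OF rT] \<gamma> cont] by blast
  next
    fix \<gamma> :: real and T'
    assume \<gamma>: "\<gamma> > 0" "(\<lambda>N. G N / real N) \<longlonglongrightarrow> \<gamma>"
      and ne: "\<forall>T\<in>{1..D div 2}. crossings D \<Lambda> d_ch lam r_max \<gamma> T \<noteq> {}"
      and max: "is_arg_max (\<lambda>T. I_fun D \<Lambda> (r_star D \<Lambda> d_ch lam r_max \<gamma> T) T) (\<lambda>T. T \<in> {1..D div 2}) T'"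
    let ?r = "\<lambda>T. r_star D \<Lambda> d_ch lam r_max \<gamma> T"
    have cross: "?r T \<in> {lam<..<r_max}" "ereal \<gamma> * I_fun D \<Lambda> (?r T) T = ereal (d_ch (?r T) T)"
      if "T \<in> {1..D div 2}" for T
      using r_star_in_crossings[OF T_bounds[OF that] assms(6) \<gamma>(1)] ne that
      by (auto simp: crossings_def)
    have T': "T' \<in> {1..D div 2}" using max by (simp add: is_arg_max_def)
    \<comment> \<open>At every crossing the channel exponent is \<open>\<gamma>\<close> times
      \<open>I_fun\<close>, so maximizing one maximizes the other.\<close>
    have best: "ereal (d_ch (?r T) T) \<le> ereal (d_ch (?r T') T')" if "T \<in> {1..D div 2}" for T
    proof -
      have "I_fun D \<Lambda> (?r T) T \<le> I_fun D \<Lambda> (?r T') T'"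
        using max that by (auto simp: is_arg_max_def not_less)
      then show ?thesis
        unfolding cross(2)[OF that, symmetric] cross(2)[OF T', symmetric]
        using \<gamma>(1) by (intro ereal_mult_left_mono) auto
    qed
    have upper: "L \<le> ereal (d_ch (?r T') T')"
      if rT: "r \<in> {lam<..<r_max}" "T \<in> {1..D div 2}" and L: "decay_exponent (?tot r T) real L" for r T L
    proof -
      interpret X: transmission g lam M A \<Lambda> P_ch d_ch r_max D T r by (rule transmission[OF rT])
      \<comment> \<open>Left of the crossing, the delay bound applies with the crossing as the
        larger gain; from the crossing on, the channel bound and antitonicity of
        \<open>d_ch\<close>.\<close>
      have "L \<le> ereal (d_ch (?r T) T)"
      proof (cases "r < ?r T")
        case True
        show ?thesis
        proof (rule ereal_le_from_above)
          fix l assume "ereal (d_ch (?r T) T) < ereal l"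
          then show "L \<le> ereal l"
            using cross(2)[OF rT(2)]
            by (intro decay_exponent_le[OF filterlim_real_sequentially L] X.proportional_at_most[OF \<gamma> True]) simp
        qed
      next
        case False
        have "d_ch r T \<le> d_ch (?r T) T"
          using False rT cross(1)[OF rT(2)] lam_pos by (intro antimono) auto
        then show ?thesis
          using X.exponent_le_d[OF L] by (meson ereal_less_eq(3) order_trans)
      qed
      also note best[OF rT(2)]
      finally show ?thesis .
    qed
    \<comment> \<open>Both exponents agree at the crossing, so the channel error alone bounds the
      total error from below there, whether or not \<open>I_fun\<close> is continuous at that
      point.\<close>
    have attained: "decay_exponent (?tot (?r T') T') real (ereal (d_ch (?r T') T'))"
    proof -
      interpret X: transmission g lam M A \<Lambda> P_ch d_ch r_max D T' "?r T'"
        by (rule transmission[OF cross(1)[OF T'] T'])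
      show ?thesis
        using cross(2)[OF T']
        by (intro decay_exponentI[OF filterlim_real_sequentially] X.proportional_at_least[OF \<gamma>] X.tot_err_at_most_d) auto
    qed
    have "Sup {L. \<exists>r\<in>{lam<..<r_max}. \<exists>T\<in>{1..D div 2}. decay_exponent (?tot r T) real L}
        = ereal (d_ch (?r T') T')"
      by (rule antisym[OF Sup_least Sup_upper]) (use upper attained cross(1)[OF T'] T' in blast)+
    then show "let r' = ?r T' in
        Sup {L. \<exists>r\<in>{lam<..<r_max}. \<exists>T\<in>{1..D div 2}. decay_exponent (?tot r T) real L} = ereal (d_ch r' T') \<and>
        ereal (d_ch r' T') = ereal \<gamma> * I_fun D \<Lambda> r' T'"
      using cross(2)[OF T'] by (simp add: Let_def)
  qed
  moreover have ?case2
  proof (intro impI conjI ballI; elim conjE)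
    fix r T
    assume slow: "(\<lambda>N. G N / real N) \<longlonglongrightarrow> 0"
      and rT: "r \<in> {lam<..<r_max}" "T \<in> {1..D div 2}" and cont: "isCont (\<lambda>x. I_fun D \<Lambda> x T) r"
    then show "\<exists>L. decay_exponent (?tot r T) G L"
      using transmission.slow_exponent[OF transmission[OF rT] slow cont] by blast
  next
    show "Sup {L. \<exists>r\<in>{lam<..<r_max}. \<exists>T\<in>{1..D div 2}. decay_exponent (?tot r T) G L}
        \<le> Max (I_fun D \<Lambda> r_max ` {1..D div 2})"
    proof (rule Sup_least, clarify)
      fix L r T
      assume "r \<in> {lam<..<r_max}" and T: "T \<in> {1..D div 2}" and L: "decay_exponent (?tot r T) G L"
      then interpret X: transmission g lam M A \<Lambda> P_ch d_ch r_max D T r by (intro transmission)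
      \<comment> \<open>Here \<open>r_max\<close> is the larger gain in the delay bound, for every
        \<open>r\<close> at once.\<close>
      have "L \<le> I_fun D \<Lambda> r_max T"
        by (rule ereal_le_from_above)
          (intro decay_exponent_le[OF G_at_top L] X.slow_at_most[OF X.r_less])
      also have "\<dots> \<le> Max (I_fun D \<Lambda> r_max ` {1..D div 2})" using T by (intro Max_ge) auto
      finally show "L \<le> Max (I_fun D \<Lambda> r_max ` {1..D div 2})" .
    qed
  qed
  moreover have ?case3
  proof (intro impI conjI ballI)
    fix r T
    assume fast: "filterlim (\<lambda>N. G N / real N) at_top sequentially"
      and rT: "r \<in> {lam<..<r_max}" "T \<in> {1..D div 2}"
    then show "\<exists>L. decay_exponent (?tot r T) real L"
      using transmission.fast_exponent[OF transmission[OF rT] fast] by blast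
  next
    show "Sup {L. \<exists>r\<in>{lam<..<r_max}. \<exists>T\<in>{1..D div 2}. decay_exponent (?tot r T) real L}
        \<le> ereal (d_ch lam (D div 2))"
    proof (rule Sup_least, clarify)
      fix L r T
      assume rT: "r \<in> {lam<..<r_max}" "T \<in> {1..D div 2}" and L: "decay_exponent (?tot r T) real L"
      interpret X: transmission g lam M A \<Lambda> P_ch d_ch r_max D T r by (rule transmission[OF rT])
      have "d_ch r T \<le> d_ch lam T" using rT lam_pos by (intro antimono) auto
      also have "\<dots> \<le> d_ch lam (D div 2)"
      proof -
        have "mono_on {1..} (d_ch lam)"
          using assms(4,6) lam_pos unfolding channel_def by auto
        then show ?thesis by (rule monotone_onD) (use rT in auto)
      qed
      finally show "L \<le> ereal (d_ch lam (D div 2))"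
        using X.exponent_le_d[OF L] by (meson ereal_less_eq(3) order_trans)
    qed
  qed
  ultimately show ?thesis by blast
qed

end
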